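(* Let $k$ be an algebraically closed field of characteristic $p>0$, let $G = \mathrm{SL}_n$ over $k$, and let $u \in G(k)$ be a unipotent element, corresponding to the partition $(m_1, \dots, m_\ell)$ of $n$. If $p^r$ is the largest power of $p$ dividing each $m_i$, then the scheme-theoretic stabilizer of the conjugacy class $C_u$ in $Z(G)$ (acting on $G$ by multiplication) is the central subgroup scheme $\mu_{p^r} \subset Z(G) = \mu_n$.
   Context: The partition $(m_1,\dots,m_\ell)$ records the Jordan block sizes of $u$. $C_u$ is the conjugacy class of $u$ in $G$ as a reduced locally closed subscheme. The scheme-theoretic stabilizer has $R$-points $\{z \in Z(G)(R) : z\cdot (C_u)_R = (C_u)_R\}$. $\mu_m$ denotes the group scheme of $m$-th roots of unity, embedded as scalar matrices. *)

theory Defs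
  imports
    "HOL-Library.Poly_Mapping"
    "HOL-Computational_Algebra.Computational_Algebra"
    "HOL-Algebra.Ideal"
    "Jordan_Normal_Form.Jordan_Normal_Form"
begin

section \<open>Coordinate rings of matrix spaces\<close>

text \<open>
  Polynomials in matrix-entry variables \<open>x\<^sub>i\<^sub>j\<close>, as finitely supported maps from monomials to
  coefficients.  The type has a variable for every pair of natural numbers; the coordinate ring
  \<open>R[x\<^sub>i\<^sub>j | i, j < n]\<close> of the affine space of \<open>n \<times> n\<close> matrices over \<open>R\<close> is the subring below.
\<close>

type_synonym 'a entry_poly = "((nat \<times> nat) \<Rightarrow>\<^sub>0 nat) \<Rightarrow>\<^sub>0 'a"

definition mat_ring :: "nat \<Rightarrow> 'a::comm_ring_1 entry_poly ring" where
  "mat_ring n =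
     \<lparr>carrier = {f. \<forall>m \<in> Poly_Mapping.keys f. Poly_Mapping.keys m \<subseteq> {..<n} \<times> {..<n}},
      mult = (*), one = 1, zero = 0, add = (+)\<rparr>"

definition const_poly :: "'a::comm_ring_1 \<Rightarrow> 'a entry_poly" where
  "const_poly c = Poly_Mapping.single 0 c"

definition generic_mat :: "nat \<Rightarrow> 'a::comm_ring_1 entry_poly mat" where
  "generic_mat n = mat n n (\<lambda>ij. Poly_Mapping.single (Poly_Mapping.single ij 1) 1)"

text \<open>Value of \<open>f\<close> at the matrix \<open>A\<close> over an algebra with structure map \<open>\<phi>\<close>.\<close>

definition eval_poly_at ::
    "('a::comm_ring_1 \<Rightarrow> 'b::comm_ring_1) \<Rightarrow> 'b mat \<Rightarrow> 'a entry_poly \<Rightarrow> 'b" where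
  "eval_poly_at \<phi> A f =
     (\<Sum>m \<in> Poly_Mapping.keys f. \<phi> (Poly_Mapping.lookup f m) *
        (\<Prod>v \<in> Poly_Mapping.keys m. (A $$ v) ^ Poly_Mapping.lookup m v))"

section \<open>The special linear group, its centre, and roots of unity\<close>

definition SL :: "nat \<Rightarrow> 'a::comm_ring_1 mat set" where
  "SL n = {A \<in> carrier_mat n n. det A = 1}"

text \<open>
  \<open>R\<close>-points of the scheme-theoretic centre: the \<open>Z \<in> SL\<^sub>n(R)\<close> that commute with \<open>SL\<^sub>n(S)\<close> for
  every \<open>R\<close>-algebra \<open>S\<close>.  By Yoneda this says that \<open>Z\<close> commutes with the universal point of
  \<open>SL\<^sub>n\<close>, which is the generic matrix over \<open>R[x\<^sub>i\<^sub>j] / (det - 1)\<close>.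
\<close>

definition SL_centre :: "nat \<Rightarrow> 'a::comm_ring_1 mat set" where
  "SL_centre n = {Z \<in> SL n.
     \<forall>i<n. \<forall>j<n.
       (map_mat const_poly Z * generic_mat n - generic_mat n * map_mat const_poly Z) $$ (i, j)
         \<in> genideal (mat_ring n) {det (generic_mat n) - 1}}"

definition mu_scalar :: "nat \<Rightarrow> nat \<Rightarrow> 'a::comm_ring_1 mat set" where
  "mu_scalar n m = {\<zeta> \<cdot>\<^sub>m 1\<^sub>m n | \<zeta>. \<zeta> ^ m = 1}"

definition unipotent_mat :: "nat \<Rightarrow> 'a::comm_ring_1 mat \<Rightarrow> bool" where
  "unipotent_mat n u \<longleftrightarrow> u \<in> carrier_mat n n \<and> (\<exists>N. (u - 1\<^sub>m n) ^\<^sub>m N = 0\<^sub>m n n)"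

definition conj_class :: "nat \<Rightarrow> 'a::comm_ring_1 mat \<Rightarrow> 'a mat set" where
  "conj_class n u = {g * u * h | g h. g \<in> SL n \<and> h \<in> SL n \<and> g * h = 1\<^sub>m n}"

section \<open>Locally closed subschemes\<close>

text \<open>
  A locally closed subscheme of \<open>Spec A\<close> is determined by its underlying set of points \<open>P\<close> together
  with, at each of these, the stalk \<open>I\<^sub>P \<subseteq> A\<^sub>P\<close> of its ideal sheaf.  Ideals of \<open>A\<^sub>P\<close> are recorded by
  their preimage in \<open>A\<close>.  So such a subscheme is encoded as the set of pairs
  (\<open>P\<close>, preimage of \<open>I\<^sub>P\<close>), and equality of these sets is equality of subschemes.

  Locally closed subschemes of \<open>SL\<^sub>n\<close> over \<open>R\<close> are regarded as locally closed subschemes of the affine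
  space of matrices, in which \<open>SL\<^sub>n\<close> is closed.
\<close>

type_synonym 'a subscheme = "('a set \<times> 'a set) set"

definition local_ideal :: "'a ring \<Rightarrow> 'a set \<Rightarrow> 'a set \<Rightarrow> 'a set" where
  "local_ideal A I P = {f \<in> carrier A. \<exists>s \<in> carrier A - P. s \<otimes>\<^bsub>A\<^esub> f \<in> I}"

text \<open>The locally closed subscheme \<open>V(I) - V(J)\<close>, with the structure induced from \<open>A/I\<close>.\<close>

definition lc_subscheme :: "'a ring \<Rightarrow> 'a set \<Rightarrow> 'a set \<Rightarrow> 'a subscheme" where
  "lc_subscheme A I J =
     {(P, local_ideal A I P) | P. primeideal P A \<and> I \<subseteq> P \<and> \<not> J \<subseteq> P}"

text \<open>Image of a subscheme under the automorphism of \<open>Spec A\<close> with comorphism \<open>\<alpha>\<close>.\<close>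

definition subscheme_image ::
    "'a ring \<Rightarrow> ('a \<Rightarrow> 'a) \<Rightarrow> 'a subscheme \<Rightarrow> 'a subscheme" where
  "subscheme_image A \<alpha> Y =
     (\<lambda>(P, I). ({f \<in> carrier A. \<alpha> f \<in> P}, {f \<in> carrier A. \<alpha> f \<in> I})) ` Y"

text \<open>\<open>Z \<cdot> Y\<close> for a matrix \<open>Z\<close> over \<open>R\<close>: left multiplication by \<open>Z\<close> has comorphism \<open>f(X) \<mapsto> f(Z X)\<close>.\<close>

definition translate_subscheme ::
    "nat \<Rightarrow> 'a::comm_ring_1 mat \<Rightarrow> 'a entry_poly subscheme \<Rightarrow> 'a entry_poly subscheme" where
  "translate_subscheme n Z =
     subscheme_image (mat_ring n) (eval_poly_at const_poly (map_mat const_poly Z * generic_mat n))"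

definition vanishing_ideal :: "nat \<Rightarrow> 'a::comm_ring_1 mat set \<Rightarrow> 'a entry_poly set" where
  "vanishing_ideal n C = {f \<in> carrier (mat_ring n). \<forall>A \<in> C. eval_poly_at id A f = 0}"

definition zariski_closure :: "nat \<Rightarrow> 'a::comm_ring_1 mat set \<Rightarrow> 'a mat set" where
  "zariski_closure n C =
     {A \<in> carrier_mat n n. \<forall>f \<in> vanishing_ideal n C. eval_poly_at id A f = 0}"

text \<open>
  A locally closed set \<open>C\<close> of \<open>k\<close>-points with its reduced structure is \<open>V(I) - V(J)\<close>, where
  \<open>I\<close> and \<open>J\<close> are the vanishing ideals of \<open>C\<close> and of its boundary.  Its base change along
  \<open>\<phi> : k \<rightarrow> R\<close> is cut out in the same way by the extended ideals.
\<close>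

definition extended_ideal ::
    "nat \<Rightarrow> ('k::comm_ring_1 \<Rightarrow> 'r::comm_ring_1) \<Rightarrow> 'k entry_poly set \<Rightarrow> 'r entry_poly set" where
  "extended_ideal n \<phi> I = genideal (mat_ring n) (Poly_Mapping.map \<phi> ` I)"

definition reduced_subscheme_base_change ::
    "nat \<Rightarrow> ('k::comm_ring_1 \<Rightarrow> 'r::comm_ring_1) \<Rightarrow> 'k mat set \<Rightarrow> 'r entry_poly subscheme" where
  "reduced_subscheme_base_change n \<phi> C =
     lc_subscheme (mat_ring n)
       (extended_ideal n \<phi> (vanishing_ideal n C))
       (extended_ideal n \<phi> (vanishing_ideal n (zariski_closure n C - C)))"

text \<open>\<open>R\<close>-points of the scheme-theoretic stabilizer of \<open>C\<^sub>u\<close> in the centre of \<open>SL\<^sub>n\<close>.\<close>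

definition class_stabilizer ::
    "nat \<Rightarrow> ('k::comm_ring_1 \<Rightarrow> 'r::comm_ring_1) \<Rightarrow> 'k mat \<Rightarrow> 'r mat set" where
  "class_stabilizer n \<phi> u =
     {Z \<in> SL_centre n.
        translate_subscheme n Z (reduced_subscheme_base_change n \<phi> (conj_class n u)) =
        reduced_subscheme_base_change n \<phi> (conj_class n u)}"

end

theory Submission
  imports Defs "Jordan_Normal_Form.Jordan_Normal_Form_Existence"
begin

text \<open>
  Write \<open>q = p\<^sup>r\<close>.  A scalar \<open>\<zeta>\<close> with \<open>\<zeta>\<^sup>q = 1\<close> is infinitesimally close to \<open>1\<close>, so it fixes every prime, and
  it preserves the extension of the ideal of the class because that ideal is graded by degree modulo \<open>q\<close>:
  if \<open>q\<close> divides all block sizes, then \<open>u\<close> is conjugate to a block matrix of companion matrices of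
  polynomials \<open>(T\<^sup>q - 1)\<^sup>a\<close>, and conjugating these with \<open>diag(1, s, s\<^sup>2, \<dots>)\<close> gives elements \<open>s\<^sup>-\<^sup>1 B(s\<^sup>q)\<close> of the
  class with \<open>B\<close> polynomial.

  Conversely, if \<open>\<zeta>\<close> stabilizes the class, then every \<open>f\<close> in the ideal of the class vanishes at \<open>\<zeta> u\<close>, because the
  class is open in its closure.  Let \<open>m = q a\<close> be a block size with \<open>p\<close> not dividing \<open>a\<close>.  The minors of
  \<open>(X - 1)\<^sup>m\<close> whose size is one more than the rank of \<open>(u - 1)\<^sup>m\<close> vanish on the class, and a suitable one of
  them takes the value \<open>a (\<zeta> - 1)\<^sup>q\<close>, up to a power of \<open>\<zeta>\<close>, at \<open>\<zeta> u\<close>.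
\<close>

section \<open>Jordan types of unipotent matrices\<close>

text \<open>Over a reduced algebra of characteristic p the only q-th root of unity is 1, because
  (\<zeta> - 1)^q = \<zeta>^q - 1. So nothing can be read off from points over fields: both
  directions must work over an algebra R that may have nilpotents and zero divisors. All geometry
  (Jordan forms, conjugation, infinitely many parameters s) is therefore done over k and carried to
  R by polynomials with coefficients in k. The exponent m in (X - 1)^m isolates the blocks of size
  m. Put \<eta> = 1 - 1/\<zeta>; up to conjugation, \<zeta> u - 1 is \<zeta> times a Jordan matrix
  with eigenvalue \<eta>. In its m-th power the larger blocks have unitriangular submatrices of the
  required size, whose determinants do not see \<eta>. Smaller blocks contribute the empty minor. A
  block of size m, whose m-th power is zero at \<eta> = 0, offers the entry (m choose q) \<eta>^q.
  This binomial coefficient equals a in characteristic p, so it is a unit in R.\<close>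

lemma similar_mat_if_intertwined:
  fixes A :: "'a::field mat"
  assumes A: "A \<in> carrier_mat n n" and B: "B \<in> carrier_mat n n" and P: "P \<in> carrier_mat n n"
    and det: "det P \<noteq> 0" and eq: "P * A = B * P"
  shows "similar_mat B A"
proof -
  from det_non_zero_imp_unit[OF P det, of "()"] obtain Q where Q: "Q \<in> carrier_mat n n"
    and PQ: "P * Q = 1\<^sub>m n" and QP: "Q * P = 1\<^sub>m n"
    unfolding Units_def ring_mat_def by auto
  have "P * A * Q = B * (P * Q)" using eq A B P Q by simp
  hence "B = P * A * Q" using PQ B by simp
  thus ?thesis using A B P Q PQ QP by (intro similar_matI[of _ _ P Q n]) auto
qed

text \<open>Exchanging coordinate 0 with a nonzero coordinate i of \<open>v\<close> gives the first
  column of a lower triangular matrix with nonzero diagonal; swapping rows 0 and i restores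
  \<open>v\<close> in that column.\<close>

lemma exists_invertible_first_col:
  fixes v :: "'a::field vec"
  assumes v: "v \<in> carrier_vec n" "v \<noteq> 0\<^sub>v n"
  shows "\<exists>P \<in> carrier_mat n n. det P \<noteq> 0 \<and> col P 0 = v \<and> 0 < n"
proof -
  from v obtain i where i: "i < n" "v $ i \<noteq> 0" by (metis eq_vecI carrier_vecD index_zero_vec)
  define sw where "sw k = (if k = 0 then i else if k = i then 0 else k)" for k
  define L where "L = mat n n (\<lambda>(a, b). if b = 0 then v $ sw a else if a = b then 1 else 0)"
  have L: "L \<in> carrier_mat n n" by (simp add: L_def)
  have "det L = prod_list (diag_mat L)"
    by (rule det_lower_triangular[OF _ L]) (auto simp: L_def)
  also have "\<dots> \<noteq> 0"
    using i by (auto simp: prod_list_zero_iff diag_mat_def L_def sw_def split: if_splits)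
  finally have dL: "det L \<noteq> 0" .
  show ?thesis
  proof (cases "i = 0")
    case True
    have "col L 0 = v" using v i True by (auto simp: L_def sw_def intro!: eq_vecI)
    thus ?thesis using L dL i by auto
  next
    case False
    have "col (swaprows 0 i L) 0 = v"
      using v i False by (auto simp: L_def sw_def mat_swaprows_def intro!: eq_vecI)
    moreover have "det (swaprows 0 i L) \<noteq> 0"
      using det_swaprows[of 0 n i L] i False L dL by auto
    ultimately show ?thesis using L i by (intro bexI[of _ "swaprows 0 i L"]) auto
  qed
qed

text \<open>Deflation: with an eigenvector as first basis vector, the first column becomes
  \<open>e\<close> times a unit vector, and the induction hypothesis triangularises the lower right
  block.\<close>

lemma similar_upper_triangular:
  fixes A :: "'a::alg_closed_field mat"
  assumes "A \<in> carrier_mat n n"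
  shows "\<exists>B \<in> carrier_mat n n. upper_triangular B \<and> similar_mat A B"
  using assms
proof (induction n arbitrary: A)
  case 0
  thus ?case by (intro bexI[of _ A]) (auto intro: similar_mat_refl)
next
  case (Suc n)
  note A = Suc.prems
  have "degree (char_poly A) > 0" using degree_monic_char_poly[OF A] by simp
  then obtain e where "poly (char_poly A) e = 0" using alg_closed_imp_poly_has_root by blast
  hence "eigenvalue A e" using eigenvalue_root_char_poly[OF A] by simp
  then obtain v where v: "v \<in> carrier_vec (Suc n)" "v \<noteq> 0\<^sub>v (Suc n)" "A *\<^sub>v v = e \<cdot>\<^sub>v v"
    using A unfolding eigenvalue_def eigenvector_def by auto
  obtain P where P: "P \<in> carrier_mat (Suc n) (Suc n)" "det P \<noteq> 0" "col P 0 = v"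
    using exists_invertible_first_col[OF v(1,2)] by auto
  from det_non_zero_imp_unit[OF P(1,2), of "()"] obtain Q where Q: "Q \<in> carrier_mat (Suc n) (Suc n)"
    and PQ: "P * Q = 1\<^sub>m (Suc n)" and QP: "Q * P = 1\<^sub>m (Suc n)"
    unfolding Units_def ring_mat_def by auto
  define C where "C = Q * A * P"
  have C: "C \<in> carrier_mat (Suc n) (Suc n)" using A P Q by (auto simp: C_def)
  have AC: "similar_mat C A"
    by (rule similar_matI[of _ _ Q P "Suc n"]) (use A C P Q PQ QP C_def in auto)
  have "col C 0 = Q * A *\<^sub>v v"
    unfolding C_def P(3)[symmetric] by (rule col_mult2) (use A P Q in auto)
  also have "\<dots> = Q *\<^sub>v (e \<cdot>\<^sub>v v)" using A Q v by simp
  also have "\<dots> = e \<cdot>\<^sub>v (Q *\<^sub>v col P 0)" using Q v P(3) by (simp add: mult_mat_vec)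
  also have "Q *\<^sub>v col P 0 = col (Q * P) 0"
    by (rule col_mult2[symmetric]) (use P Q in auto)
  finally have colC: "col C 0 = e \<cdot>\<^sub>v unit_vec (Suc n) 0" unfolding QP by simp
  define A1 where "A1 = mat 1 1 (\<lambda>_. e)"
  define A2 where "A2 = mat 1 n (\<lambda>(i, j). C $$ (0, Suc j))"
  define A4 where "A4 = mat n n (\<lambda>(i, j). C $$ (Suc i, Suc j))"
  have Ci0: "C $$ (i, 0) = (if i = 0 then e else 0)" if "i < Suc n" for i
    using arg_cong[OF colC, of "\<lambda>w. vec_index w i"] that C by (auto split: if_splits)
  have Ceq: "C = four_block_mat A1 A2 (0\<^sub>m n 1) A4"
    by (rule eq_matI) (use C Ci0 in \<open>auto simp: A1_def A2_def A4_def\<close>)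
  obtain B4 where B4: "B4 \<in> carrier_mat n n" "upper_triangular B4" "similar_mat A4 B4"
    using Suc.IH[of A4] by (auto simp: A4_def)
  have "A1 \<in> carrier_mat 1 1" "A2 \<in> carrier_mat 1 n" "A4 \<in> carrier_mat n n"
    by (auto simp: A1_def A2_def A4_def)
  then obtain B2 where B2: "B2 \<in> carrier_mat 1 n"
    "similar_mat C (four_block_mat A1 B2 (0\<^sub>m n 1) B4)"
    using similar_mat_four_block_0_ex[OF similar_mat_refl[of A1 1] B4(3), of A2 1 n] Ceq by auto
  have "upper_triangular (four_block_mat A1 B2 (0\<^sub>m n 1) B4)"
    by (rule upper_triangular_four_block[of _ 1 _ n]) (use B4 in \<open>auto simp: A1_def\<close>)
  moreover have "four_block_mat A1 B2 (0\<^sub>m n 1) B4 \<in> carrier_mat (Suc n) (Suc n)"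
    using B4 B2 by (auto simp: A1_def)
  ultimately show ?case using AC B2(2) similar_mat_sym similar_mat_trans by blast
qed

lemma pow_mat_mult_eigenvector:
  fixes A :: "'a::field mat"
  assumes "A \<in> carrier_mat n n" "v \<in> carrier_vec n" "A *\<^sub>v v = c \<cdot>\<^sub>v v"
  shows "A ^\<^sub>m N *\<^sub>v v = c ^ N \<cdot>\<^sub>v v"
proof (induction N)
  case (Suc N)
  have "A ^\<^sub>m Suc N *\<^sub>v v = A ^\<^sub>m N *\<^sub>v (A *\<^sub>v v)"
    using assms by (simp add: assoc_mult_mat_vec[of _ n n _ n])
  also have "\<dots> = c \<cdot>\<^sub>v (A ^\<^sub>m N *\<^sub>v v)"
    unfolding assms(3) using mult_mat_vec[of "A ^\<^sub>m N" n n v c] assms by simp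
  finally show ?case using Suc by (simp add: smult_smult_assoc)
qed (use assms in auto)

text \<open>Every eigenvalue is 1, since \<open>(A - 1)^N = 0\<close> multiplies an eigenvector for
  a by (a - 1)^N.\<close>

lemma unipotent_jordan_nf:
  fixes A :: "'a::alg_closed_field mat"
  assumes "unipotent_mat n A"
  shows "\<exists>ms. jordan_nf A (map (\<lambda>m. (m, 1)) ms)"
proof -
  from assms obtain N where A: "A \<in> carrier_mat n n" and N: "(A - 1\<^sub>m n) ^\<^sub>m N = 0\<^sub>m n n"
    by (auto simp: unipotent_mat_def)
  obtain B where B: "B \<in> carrier_mat n n" "upper_triangular B" "similar_mat A B"
    using similar_upper_triangular[OF A] by auto
  obtain js where jnf: "jordan_nf A js"
    using triangular_to_jnf_vector[OF B(1,2)] B(3) similar_mat_trans unfolding jordan_nf_def by blast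
  have one: "a = 1" if "(m, a) \<in> set js" for m a
  proof -
    have "m \<noteq> 0" using jnf that by (force simp: jordan_nf_def)
    hence "poly (char_poly A) a = 0"
      unfolding jordan_nf_char_poly[OF jnf] poly_prod_list prod_list_zero_iff using that by force
    hence "eigenvalue A a" using eigenvalue_root_char_poly[OF A] by simp
    then obtain v where v: "v \<in> carrier_vec n" "v \<noteq> 0\<^sub>v n" "A *\<^sub>v v = a \<cdot>\<^sub>v v"
      using A unfolding eigenvalue_def eigenvector_def by auto
    have "(A - 1\<^sub>m n) *\<^sub>v v = (a - 1) \<cdot>\<^sub>v v"
      using v A by (simp add: minus_mult_distrib_mat_vec) (auto simp: algebra_simps)
    hence "(a - 1) ^ N \<cdot>\<^sub>v v = (A - 1\<^sub>m n) ^\<^sub>m N *\<^sub>v v"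
      by (intro pow_mat_mult_eigenvector[symmetric, where n = n] minus_carrier_mat) (use v A in auto)
    also have "\<dots> = 0\<^sub>v n" unfolding N using v by (auto simp: scalar_prod_def intro!: eq_vecI)
    finally have "(a - 1) ^ N = 0" using v
      by (metis carrier_vecD eq_vecI index_smult_vec(1) index_zero_vec mult_eq_0_iff)
    thus "a = 1" by simp
  qed
  have "js = map (\<lambda>m. (m, 1)) (map fst js)"
    using one by (induction js) auto
  thus ?thesis using jnf by metis
qed

section \<open>Permuting Jordan blocks and recovering a partition from ranks\<close>

lemma jordan_matrix_append:
  "jordan_matrix (xs @ ys) = four_block_mat (jordan_matrix xs)
     (0\<^sub>m (sum_list (map fst xs)) (sum_list (map fst ys)))
     (0\<^sub>m (sum_list (map fst ys)) (sum_list (map fst xs))) (jordan_matrix ys)"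
  using jordan_matrix_dim[of xs] jordan_matrix_dim[of ys]
  by (simp add: jordan_matrix_def diag_block_mat_append Let_def)

lemma similar_mat_swap_blocks:
  fixes A :: "'a::comm_ring_1 mat"
  assumes A: "A \<in> carrier_mat a a" and B: "B \<in> carrier_mat b b"
  shows "similar_mat (four_block_mat A (0\<^sub>m a b) (0\<^sub>m b a) B)
           (four_block_mat B (0\<^sub>m b a) (0\<^sub>m a b) A)"
proof -
  let ?P = "four_block_mat (0\<^sub>m a b) (1\<^sub>m a) (1\<^sub>m b) (0\<^sub>m b a) :: 'a mat"
  let ?Q = "four_block_mat (0\<^sub>m b a) (1\<^sub>m b) (1\<^sub>m a) (0\<^sub>m a b) :: 'a mat"
  have PQ: "?P * ?Q = 1\<^sub>m (a + b)" 
    by (subst mult_four_block_mat[of _ a b _ a _ b _ _ a _ b]) auto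
  have QP: "?Q * ?P = 1\<^sub>m (b + a)" 
    by (subst mult_four_block_mat[of _ b a _ b _ a _ _ b _ a]) auto
  have PB: "?P * four_block_mat B (0\<^sub>m b a) (0\<^sub>m a b) A = four_block_mat (0\<^sub>m a b) A B (0\<^sub>m b a)"
    by (subst mult_four_block_mat[of _ a b _ a _ b _ _ b _ a]) (use A B in auto)
  have PBQ: "four_block_mat (0\<^sub>m a b) A B (0\<^sub>m b a) * ?Q = four_block_mat A (0\<^sub>m a b) (0\<^sub>m b a) B"
    by (subst mult_four_block_mat[of _ a b _ a _ b _ _ a _ b]) (use A B in auto)
  have c: "?P \<in> carrier_mat (a + b) (b + a)" "?Q \<in> carrier_mat (b + a) (a + b)"
    "four_block_mat A (0\<^sub>m a b) (0\<^sub>m b a) B \<in> carrier_mat (a + b) (a + b)"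
    "four_block_mat B (0\<^sub>m b a) (0\<^sub>m a b) A \<in> carrier_mat (b + a) (b + a)"
    using A B by (simp_all only: four_block_carrier_mat one_carrier_mat zero_carrier_mat)
  show ?thesis
    by (rule similar_matI[of _ _ ?P ?Q "a + b"])
       (use c PQ QP PB PBQ in \<open>auto simp: add.commute\<close>)
qed

text \<open>Needed because rank data determine block sizes only as a multiset. The head of
  \<open>xs\<close> is located inside \<open>ys\<close> and moved to the front by one block
  swap.\<close>

lemma similar_jordan_matrix_perm:
  fixes xs :: "(nat \<times> 'a::comm_ring_1) list"
  assumes "mset xs = mset ys"
  shows "similar_mat (jordan_matrix xs) (jordan_matrix ys)"
  using assms
proof (induction xs arbitrary: ys)
  case Nil
  thus ?case by (auto intro: similar_mat_refl[OF jordan_matrix_carrier])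
next
  case (Cons x xs)
  from Cons.prems have "x \<in> set ys" by (metis list.set_intros(1) mset_eq_setD)
  then obtain as bs where ys: "ys = as @ x # bs" by (meson split_list)
  have "mset xs = mset (as @ bs)" using Cons.prems ys by simp
  from Cons.IH[OF this] have IH: "similar_mat (jordan_matrix xs) (jordan_matrix (as @ bs))" .
  have dim: "sum_list (map fst xs) = sum_list (map fst (as @ bs))"
    using \<open>mset xs = mset (as @ bs)\<close> by (metis mset_map sum_mset_sum_list)
  have 1: "similar_mat (jordan_matrix ([x] @ xs)) (jordan_matrix ([x] @ (as @ bs)))"
    unfolding jordan_matrix_append[of "[x]"] dim
    by (rule similar_mat_four_block_0_0)
       (use IH dim jordan_matrix_carrier[of xs] in
          \<open>auto intro: similar_mat_refl[OF jordan_matrix_carrier] simp del: jordan_matrix_carrier\<close>)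
  have "similar_mat (jordan_matrix ([x] @ as)) (jordan_matrix (as @ [x]))"
    unfolding jordan_matrix_append by (rule similar_mat_swap_blocks) auto
  moreover have "sum_list (map fst (as @ [x])) = sum_list (map fst ([x] @ as))" by simp
  ultimately have 2: "similar_mat (jordan_matrix (([x] @ as) @ bs)) (jordan_matrix ((as @ [x]) @ bs))"
    unfolding jordan_matrix_append[of "[x] @ as" bs] jordan_matrix_append[of "as @ [x]" bs]
    by (metis (mono_tags) jordan_matrix_carrier similar_mat_four_block_0_0 similar_mat_refl)
  show ?case using similar_mat_trans[OF 1] 2 by (simp add: ys)
qed

text \<open>The sum for j is the rank of (u - 1)^j. Its first difference counts the blocks larger
  than j, and the second difference counts those of size j + 1. Zeros are invisible to these sums
  and have to be excluded.\<close>

lemma mset_eq_if_truncated_sums_eq: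
  fixes xs ys :: "nat list"
  assumes "\<And>j. (\<Sum>m\<leftarrow>xs. m - j) = (\<Sum>m\<leftarrow>ys. m - j)" and "0 \<notin> set xs" "0 \<notin> set ys"
  shows "mset xs = mset ys"
proof -
  have step: "(\<Sum>m\<leftarrow>zs. m - j) = (\<Sum>m\<leftarrow>zs. m - Suc j) + length (filter (\<lambda>m. j < m) zs)"
    for zs :: "nat list" and j by (induction zs) auto
  have len: "length (filter (\<lambda>m. j < m) xs) = length (filter (\<lambda>m. j < m) ys)" for j
    using step[of j xs] step[of j ys] assms(1)[of j] assms(1)[of "Suc j"] by simp
  have count: "length (filter (\<lambda>m. j < m) zs) = length (filter (\<lambda>m. Suc j < m) zs) + count (mset zs) (Suc j)"
    for zs j by (induction zs) auto
  show ?thesis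
  proof (rule multiset_eqI)
    fix x show "count (mset xs) x = count (mset ys) x"
    proof (cases x)
      case 0
      thus ?thesis using assms(2,3) by (metis count_mset_0_iff)
    next
      case (Suc j)
      thus ?thesis using count[of j xs] count[of j ys] len[of j] len[of "Suc j"] by simp
    qed
  qed
qed

section \<open>Generalised minors of powers of Jordan matrices\<close>

lemma four_block_diag_mult3:
  fixes M1 :: "'a::comm_ring_1 mat"
  assumes "P1 \<in> carrier_mat a1 b1" "M1 \<in> carrier_mat b1 c1" "Q1 \<in> carrier_mat c1 d1"
    and "P2 \<in> carrier_mat a2 b2" "M2 \<in> carrier_mat b2 c2" "Q2 \<in> carrier_mat c2 d2"
  shows "four_block_mat P1 (0\<^sub>m a1 b2) (0\<^sub>m a2 b1) P2 * four_block_mat M1 (0\<^sub>m b1 c2) (0\<^sub>m b2 c1) M2 *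
      four_block_mat Q1 (0\<^sub>m c1 d2) (0\<^sub>m c2 d1) Q2 =
    four_block_mat (P1 * M1 * Q1) (0\<^sub>m a1 d2) (0\<^sub>m a2 d1) (P2 * M2 * Q2)"
proof -
  have 1: "four_block_mat P1 (0\<^sub>m a1 b2) (0\<^sub>m a2 b1) P2 * four_block_mat M1 (0\<^sub>m b1 c2) (0\<^sub>m b2 c1) M2
    = four_block_mat (P1 * M1) (0\<^sub>m a1 c2) (0\<^sub>m a2 c1) (P2 * M2)"
    by (subst mult_four_block_mat[of _ a1 b1 _ b2 _ a2]) (use assms in auto)
  show ?thesis unfolding 1
    by (subst mult_four_block_mat[of _ a1 c1 _ c2 _ a2]) (use assms in auto)
qed

text \<open>\<open>P\<close> and \<open>Q\<close> are arbitrary rather than selections of rows and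
  columns, so that a base change can be absorbed into them. Their entries come from the source of
  \<open>\<psi>\<close>, since the equation built from them must have coefficients in k even when
  \<open>M\<close> lives over R.\<close>

definition has_minor :: "('a::comm_ring_1 \<Rightarrow> 'b::comm_ring_1) \<Rightarrow> 'b mat \<Rightarrow> nat \<Rightarrow> 'b \<Rightarrow> bool" where
  "has_minor \<psi> M s d \<longleftrightarrow> (\<exists>P \<in> carrier_mat s (dim_row M). \<exists>Q \<in> carrier_mat (dim_col M) s.
     det (map_mat \<psi> P * M * map_mat \<psi> Q) = d)"


lemma has_minor_four_block:
  fixes M1 M2 :: "'d::idom mat"
  assumes \<psi>: "comm_ring_hom \<psi>"
    and "has_minor \<psi> M1 s1 d1" "has_minor \<psi> M2 s2 d2"
    and M: "M1 \<in> carrier_mat a a" "M2 \<in> carrier_mat b b"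
  shows "has_minor \<psi> (four_block_mat M1 (0\<^sub>m a b) (0\<^sub>m b a) M2) (s1 + s2) (d1 * d2)"
proof -
  interpret \<psi>: comm_ring_hom \<psi> by fact
  from assms obtain P1 Q1 P2 Q2 where c: "P1 \<in> carrier_mat s1 a" "Q1 \<in> carrier_mat a s1"
    "P2 \<in> carrier_mat s2 b" "Q2 \<in> carrier_mat b s2"
    and d: "det (map_mat \<psi> P1 * M1 * map_mat \<psi> Q1) = d1" "det (map_mat \<psi> P2 * M2 * map_mat \<psi> Q2) = d2"
    unfolding has_minor_def by auto
  let ?P = "four_block_mat P1 (0\<^sub>m s1 b) (0\<^sub>m s2 a) P2"
  let ?Q = "four_block_mat Q1 (0\<^sub>m a s2) (0\<^sub>m b s1) Q2"
  have P: "map_mat \<psi> ?P = four_block_mat (map_mat \<psi> P1) (0\<^sub>m s1 b) (0\<^sub>m s2 a) (map_mat \<psi> P2)"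
    by (subst map_four_block_mat[of _ s1 a _ b _ s2]) (use c in auto)
  have Q: "map_mat \<psi> ?Q = four_block_mat (map_mat \<psi> Q1) (0\<^sub>m a s2) (0\<^sub>m b s1) (map_mat \<psi> Q2)"
    by (subst map_four_block_mat[of _ a s1 _ s2 _ b]) (use c in auto)
  have "det (map_mat \<psi> ?P * four_block_mat M1 (0\<^sub>m a b) (0\<^sub>m b a) M2 * map_mat \<psi> ?Q) = d1 * d2"
    unfolding P Q
    by (subst four_block_diag_mult3[of _ s1 a _ a _ s1 _ s2 b _ b _ s2], (use c M in auto)[6],
        subst det_four_block_mat_lower_left_zero[of _ s1 _ s2], use c M d in auto)
  moreover have "?P \<in> carrier_mat (s1 + s2) (a + b)" "?Q \<in> carrier_mat (a + b) (s1 + s2)"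
    using c by auto
  ultimately show ?thesis unfolding has_minor_def using M by auto
qed

lemma select_submatrix:
  fixes M :: "'a::comm_ring_1 mat"
  assumes M: "M \<in> carrier_mat a b" and f: "\<And>i. i < s \<Longrightarrow> f i < a" and g: "\<And>j. j < t \<Longrightarrow> g j < b"
  shows "mat s a (\<lambda>(i, j). if j = f i then 1 else 0) * M * mat b t (\<lambda>(i, j). if i = g j then 1 else 0)
    = mat s t (\<lambda>(i, j). M $$ (f i, g j))" (is "?P * M * ?Q = _")
proof (rule eq_matI)
  fix i j assume "i < dim_row (mat s t (\<lambda>(i, j). M $$ (f i, g j)))" "j < dim_col (mat s t (\<lambda>(i, j). M $$ (f i, g j)))"
  hence i: "i < s" and j: "j < t" by auto
  have PM: "(?P * M) $$ (i, l) = M $$ (f i, l)" if "l < b" for l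
    using M i f[OF i] that
    by (simp add: scalar_prod_def sum.delta if_distrib[of "\<lambda>x. x * _"] cong: if_cong)
  have "(?P * M * ?Q) $$ (i, j) = (\<Sum>l\<in>{0..<b}. (?P * M) $$ (i, l) * ?Q $$ (l, j))"
    using M i j by (simp add: scalar_prod_def)
  also have "\<dots> = (\<Sum>l\<in>{0..<b}. if l = g j then M $$ (f i, l) else 0)"
    by (rule sum.cong) (use PM i j in auto)
  also have "\<dots> = M $$ (f i, g j)" using g[OF j] by simp
  finally show "(?P * M * ?Q) $$ (i, j) = mat s t (\<lambda>(i, j). M $$ (f i, g j)) $$ (i, j)"
    using i j by simp
qed (use M in auto)

lemma has_minor_select:
  assumes "comm_ring_hom \<psi>" and M: "M \<in> carrier_mat a b"
    and f: "\<And>i. i < s \<Longrightarrow> f i < a" and g: "\<And>j. j < s \<Longrightarrow> g j < b"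
  shows "has_minor \<psi> M s (det (mat s s (\<lambda>(i, j). M $$ (f i, g j))))"
proof -
  interpret comm_ring_hom \<psi> by fact
  let ?P = "mat s a (\<lambda>(i, j). if j = f i then 1 else 0)"
  let ?Q = "mat b s (\<lambda>(i, j). if i = g j then 1 else 0)"
  have 1: "map_mat \<psi> ?P = mat s a (\<lambda>(i, j). if j = f i then 1 else 0)" by (rule eq_matI) auto
  have 2: "map_mat \<psi> ?Q = mat b s (\<lambda>(i, j). if i = g j then 1 else 0)" by (rule eq_matI) auto
  have "det (map_mat \<psi> ?P * M * map_mat \<psi> ?Q) = det (mat s s (\<lambda>(i, j). M $$ (f i, g j)))"
    unfolding 1 2 by (subst select_submatrix[OF M f g]) auto
  thus ?thesis unfolding has_minor_def using M
    by (intro bexI[of _ ?P] bexI[of _ ?Q]) auto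
qed

text \<open>Entry (i, m + j) of the power is (m choose m + j - i) \<eta>^(i - j) for j \<le> i, and
  zero for j > i. The columns from m on, with as many of the top rows, are therefore lower
  unitriangular for every \<eta>. If m' \<le> m the determinant is empty.\<close>

lemma has_minor_jordan_block:
  assumes "comm_ring_hom \<psi>"
  shows "has_minor \<psi> (jordan_block m' \<eta> ^\<^sub>m m) (m' - m) 1"
proof -
  let ?N = "mat (m' - m) (m' - m) (\<lambda>(i, j). (jordan_block m' \<eta> ^\<^sub>m m) $$ (i, m + j))"
  have "det ?N = prod_list (diag_mat ?N)"
    by (rule det_lower_triangular[of "m' - m"]) (auto simp: jordan_block_pow binomial_eq_0)
  also have "diag_mat ?N = replicate (m' - m) 1"
    by (auto simp: diag_mat_def jordan_block_pow intro!: nth_equalityI)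
  finally have "det ?N = 1" by simp
  thus ?thesis
    using has_minor_select[OF assms, of "jordan_block m' \<eta> ^\<^sub>m m" m' m' "m' - m" "\<lambda>i. i" "\<lambda>j. m + j"]
    by simp
qed

text \<open>In the top row the power of \<eta> falls by one with each column, and column m - q is
  the one where it is \<eta>^q.\<close>

lemma has_minor_jordan_block_same_size:
  assumes "comm_ring_hom \<psi>" "0 < q" "q \<le> m"
  shows "has_minor \<psi> (jordan_block m \<eta> ^\<^sub>m m) 1 (of_nat (m choose q) * \<eta> ^ q)"
proof -
  let ?N = "mat 1 1 (\<lambda>(i, j). (jordan_block m \<eta> ^\<^sub>m m) $$ (0, m - q))"
  have "det ?N = of_nat (m choose q) * \<eta> ^ q"
    using assms by (subst det_single) (auto simp: jordan_block_pow binomial_symmetric[of q m])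
  thus ?thesis
    using has_minor_select[OF assms(1), of "jordan_block m \<eta> ^\<^sub>m m" m m 1 "\<lambda>i. 0" "\<lambda>j. m - q"] assms
    by simp
qed

abbreviation jordan_type :: "nat list \<Rightarrow> 'a::{zero,one} \<Rightarrow> 'a mat" where
  "jordan_type ms a \<equiv> jordan_matrix (map (\<lambda>m. (m, a)) ms)"

lemma jordan_type_carrier: "jordan_type ms a \<in> carrier_mat (sum_list ms) (sum_list ms)"
  using jordan_matrix_carrier[of "map (\<lambda>m. (m, a)) ms"] by (simp add: o_def)

lemma jordan_type_Cons:
  "jordan_type (m # ms) a = four_block_mat (jordan_block m a) (0\<^sub>m m (sum_list ms))
     (0\<^sub>m (sum_list ms) m) (jordan_type ms a)"
  by (simp add: jordan_matrix_Cons o_def)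

lemma jordan_type_pow_Cons:
  fixes a :: "'a::comm_ring_1"
  shows "jordan_type (m # ms) a ^\<^sub>m k = four_block_mat (jordan_block m a ^\<^sub>m k) (0\<^sub>m m (sum_list ms))
     (0\<^sub>m (sum_list ms) m) (jordan_type ms a ^\<^sub>m k)"
  unfolding jordan_type_Cons by (rule pow_four_block_mat) (auto simp: jordan_type_carrier)

text \<open>The size is the rank of the k-th power at \<eta> = 0; the block minors multiply to 1 for
  every \<eta>.\<close>

lemma has_minor_jordan_type:
  fixes \<eta> :: "'b::idom"
  assumes "comm_ring_hom \<psi>"
  shows "has_minor \<psi> (jordan_type ms \<eta> ^\<^sub>m k) (\<Sum>m\<leftarrow>ms. m - k) 1"
proof (induction ms)
  case Nil
  have "jordan_matrix [] = (0\<^sub>m 0 0 :: 'b mat)" by (simp add: jordan_matrix_def)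
  thus ?case unfolding has_minor_def
    by (intro bexI[of _ "0\<^sub>m 0 0"]) (auto intro!: det_dim_zero carrier_matI)
next
  case (Cons m ms)
  interpret comm_ring_hom \<psi> by fact
  have "has_minor \<psi> (jordan_type (m # ms) \<eta> ^\<^sub>m k) ((m - k) + (\<Sum>m\<leftarrow>ms. m - k)) (1 * 1)"
    unfolding jordan_type_pow_Cons
    by (rule has_minor_four_block[OF assms has_minor_jordan_block[OF assms] Cons])
       (auto intro: pow_carrier_mat jordan_type_carrier)
  thus ?case by simp
qed

text \<open>One block of size m contributes a minor of size 1 in place of its empty one, so the
  total size exceeds by one the rank at \<eta> = 0. Such minors vanish on the class but not
  identically in \<eta>.\<close>

lemma has_minor_jordan_type_extra:
  fixes \<eta> :: "'b::idom"
  assumes "comm_ring_hom \<psi>" "0 < q" "q \<le> m" "m \<in> set ms"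
  shows "has_minor \<psi> (jordan_type ms \<eta> ^\<^sub>m m) (Suc (\<Sum>m'\<leftarrow>ms. m' - m)) (of_nat (m choose q) * \<eta> ^ q)"
  using assms(4)
proof (induction ms)
  case (Cons m' ms)
  interpret comm_ring_hom \<psi> by fact
  have c: "jordan_block m' \<eta> ^\<^sub>m m \<in> carrier_mat m' m'"
    "jordan_type ms \<eta> ^\<^sub>m m \<in> carrier_mat (sum_list ms) (sum_list ms)"
    by (auto intro: pow_carrier_mat jordan_type_carrier)
  show ?case
  proof (cases "m' = m")
    case True
    show ?thesis
      using has_minor_four_block[OF assms(1) has_minor_jordan_block_same_size[OF assms(1-3)]
          has_minor_jordan_type[OF assms(1)] c[unfolded True]]
      unfolding jordan_type_pow_Cons True by simp
  next
    case False
    with Cons.prems have "m \<in> set ms" by simp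
    from has_minor_four_block[OF assms(1) has_minor_jordan_block[OF assms(1)] Cons.IH[OF this] c]
    show ?thesis unfolding jordan_type_pow_Cons by simp
  qed
qed simp

section \<open>Upper bounds for ranks\<close>

definition factors_through :: "nat \<Rightarrow> 'a::comm_ring_1 mat \<Rightarrow> bool" where
  "factors_through s M \<longleftrightarrow>
     (\<exists>B \<in> carrier_mat (dim_row M) s. \<exists>C \<in> carrier_mat s (dim_col M). M = B * C)"

text \<open>On a nilpotent block the k-th power is the shift by k places, which factors through the
  m - k coordinates that survive it.\<close>

lemma factors_through_jordan_type_0:
  "factors_through (\<Sum>m\<leftarrow>ms. m - k) (jordan_type ms (0::'a::field) ^\<^sub>m k)"
proof (induction ms)
  case Nil
  have "jordan_matrix [] = (0\<^sub>m 0 0 :: 'a mat)" by (simp add: jordan_matrix_def)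
  thus ?case unfolding factors_through_def by (intro bexI[of _ "0\<^sub>m 0 0"]) auto
next
  case (Cons m ms)
  let ?n = "sum_list ms" and ?s = "\<Sum>m\<leftarrow>ms. m - k" and ?M = "jordan_type ms (0::'a) ^\<^sub>m k"
  have M: "?M \<in> carrier_mat ?n ?n" by (intro pow_carrier_mat jordan_type_carrier)
  with Cons obtain B C where BC: "B \<in> carrier_mat ?n ?s" "C \<in> carrier_mat ?s ?n" "?M = B * C"
    unfolding factors_through_def carrier_matD[OF M] by blast
  define B1 :: "'a mat" where "B1 = mat m (m - k) (\<lambda>(i, j). if i = j then 1 else 0)"
  define C1 :: "'a mat" where "C1 = mat (m - k) m (\<lambda>(i, j). if j = k + i then 1 else 0)"
  have c1: "B1 \<in> carrier_mat m (m - k)" "C1 \<in> carrier_mat (m - k) m" by (auto simp: B1_def C1_def)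
  have BC1: "jordan_block m (0::'a) ^\<^sub>m k = B1 * C1"
  proof (rule eq_matI)
    fix i j assume "i < dim_row (B1 * C1)" "j < dim_col (B1 * C1)"
    hence ij: "i < m" "j < m" using c1 by auto
    have "(B1 * C1) $$ (i, j) = (\<Sum>l\<in>{0..<m - k}. B1 $$ (i, l) * C1 $$ (l, j))"
      using ij c1 by (simp add: scalar_prod_def)
    also have "\<dots> = (\<Sum>l\<in>{0..<m - k}. if l = i then (if j = k + i then 1 else 0) else 0)"
      by (rule sum.cong) (use ij in \<open>auto simp: B1_def C1_def\<close>)
    also have "\<dots> = (jordan_block m 0 ^\<^sub>m k) $$ (i, j)"
      using ij by (auto simp: jordan_block_zero_pow)
    finally show "(jordan_block m 0 ^\<^sub>m k) $$ (i, j) = (B1 * C1) $$ (i, j)" by simp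
  qed (use c1 in auto)
  let ?B = "four_block_mat B1 (0\<^sub>m m ?s) (0\<^sub>m ?n (m - k)) B"
  let ?C = "four_block_mat C1 (0\<^sub>m (m - k) ?n) (0\<^sub>m ?s m) C"
  have "?B * ?C = jordan_type (m # ms) 0 ^\<^sub>m k"
    unfolding jordan_type_pow_Cons BC1 BC(3)
    by (subst mult_four_block_mat[of _ m "m - k" _ ?s _ ?n]) (use BC c1 in auto)
  moreover have "jordan_type (m # ms) (0::'a) ^\<^sub>m k \<in> carrier_mat (m + ?n) (m + ?n)"
    using jordan_type_carrier[of "0::'a" "m # ms"] by (intro pow_carrier_mat) simp
  moreover have "?B \<in> carrier_mat (m + ?n) ((m - k) + ?s)" "?C \<in> carrier_mat ((m - k) + ?s) (m + ?n)"
    using BC c1 by auto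
  ultimately show ?case unfolding factors_through_def
    by (intro bexI[of _ ?B] bexI[of _ ?C]) auto
qed

text \<open>Padding both factors with zeros to square matrices leaves the product unchanged, and
  column t of the padded left factor is zero.\<close>

lemma det_mult_eq_0_if_factors:
  fixes X :: "'a::idom mat"
  assumes X: "X \<in> carrier_mat s t" and Y: "Y \<in> carrier_mat t s" and ts: "t < s"
  shows "det (X * Y) = 0"
proof -
  define X' where "X' = mat s s (\<lambda>(i, j). if j < t then X $$ (i, j) else 0)"
  define Y' where "Y' = mat s s (\<lambda>(i, j). if i < t then Y $$ (i, j) else 0)"
  have c: "X' \<in> carrier_mat s s" "Y' \<in> carrier_mat s s" by (auto simp: X'_def Y'_def)
  have "X * Y = X' * Y'"
  proof (rule eq_matI)
    fix i j assume "i < dim_row (X' * Y')" "j < dim_col (X' * Y')"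
    hence ij: "i < s" "j < s" using c by auto
    have "(X' * Y') $$ (i, j) = (\<Sum>l\<in>{0..<s}. if l < t then X $$ (i, l) * Y $$ (l, j) else 0)"
      using ij by (auto simp: X'_def Y'_def scalar_prod_def intro!: sum.cong)
    also have "\<dots> = (\<Sum>l\<in>{0..<t}. X $$ (i, l) * Y $$ (l, j))"
      using ts by (intro sum.mono_neutral_cong_right) auto
    also have "\<dots> = (X * Y) $$ (i, j)" using ij X Y by (simp add: scalar_prod_def)
    finally show "(X * Y) $$ (i, j) = (X' * Y') $$ (i, j)" by simp
  qed (use X Y c in auto)
  moreover have "det X' = 0"
    unfolding det_0_iff_vec_prod_zero[OF c(1)]
  proof (intro exI conjI)
    show "unit_vec s t \<noteq> 0\<^sub>v s" using ts by simp
    show "X' *\<^sub>v unit_vec s t = 0\<^sub>v s"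
      using ts by (intro eq_vecI) (auto simp: X'_def scalar_prod_def unit_vec_def if_distrib sum.delta cong: if_cong)
  qed auto
  ultimately show ?thesis using det_mult[OF c] by simp
qed

section \<open>Binomial identities in characteristic p and cyclic normal forms\<close>

lemma CHAR_eq_if_comm_ring_hom:
  fixes \<phi> :: "'a::comm_ring_1 \<Rightarrow> 'b::comm_ring_1"
  assumes "comm_ring_hom \<phi>" "prime CHAR('a)"
  shows "CHAR('b) = CHAR('a)"
proof -
  interpret comm_ring_hom \<phi> by fact
  have "(of_nat CHAR('a) :: 'b) = \<phi> (of_nat CHAR('a))" by (simp only: hom_of_nat)
  hence "CHAR('b) dvd CHAR('a)" by (simp add: of_nat_eq_0_iff_char_dvd[symmetric])
  moreover have "CHAR('b) \<noteq> 1" by (metis of_nat_1 of_nat_CHAR zero_neq_one)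
  ultimately show ?thesis using assms(2) prime_nat_iff by blast
qed

lemma CHAR_poly:
  assumes "prime CHAR('a::comm_ring_1)"
  shows "CHAR('a poly) = CHAR('a)"
  using assms by (intro CHAR_eq_if_comm_ring_hom[of "\<lambda>c. [:c:]"]) (unfold_locales, auto simp: one_pCons)

lemma power_prime_power_minus_one:
  fixes x :: "'a::comm_ring_1"
  assumes "prime CHAR('a)" "q = CHAR('a) ^ r"
  shows "(x - 1) ^ q = x ^ q - 1"
  using freshmans_dream'[OF assms, of "x - 1" 1] by (simp add: algebra_simps)

text \<open>A case of Lucas' theorem: compare the coefficients of T^q in (1 + T)^(q a) = (1 +
  T^q)^a.\<close>

lemma of_nat_binomial_prime_power:
  assumes "prime CHAR('a::comm_ring_1)" "q = CHAR('a) ^ r"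
  shows "of_nat (q * a choose q) = (of_nat a :: 'a)"
proof -
  have q: "q > 0" using assms prime_gt_0_nat by simp
  have "[:1, 1:] ^ q = (1 + [:0, 1:] :: 'a poly) ^ q" by (simp add: one_pCons)
  also have "\<dots> = 1 + monom 1 q"
    using freshmans_dream'[of q r 1 "[:0, 1:] :: 'a poly"] assms CHAR_poly[OF assms(1)]
    by (simp add: monom_altdef)
  finally have "[:1, 1:] ^ (q * a) = (monom (1::'a) q + 1) ^ a" by (simp add: power_mult add.commute)
  also have "\<dots> = (\<Sum>b\<le>a. monom (of_nat (a choose b)) (q * b))"
    unfolding binomial_ring
    by (intro sum.cong) (auto simp: monom_power of_nat_poly smult_monom mult.commute)
  finally have "coeff ([:1, 1:] ^ (q * a) :: 'a poly) q = (\<Sum>b\<le>a. if q * b = q then of_nat (a choose b) else 0)"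
    by (simp add: coeff_sum)
  also have "\<dots> = (\<Sum>b\<le>a. if b = 1 then of_nat (a choose b) else 0)"
    using q by (intro sum.cong) auto
  also have "\<dots> = of_nat a" by (cases a) (auto simp: sum.delta)
  finally show ?thesis by (cases "a = 0") (use q in \<open>auto simp: coeff_linear_poly_power binomial_eq_0\<close>)
qed

text \<open>The matrix of multiplication by \<open>T\<close> in the power basis of \<open>k[T] / (T\<^sup>q - w)\<^sup>a\<close>, up to transposition.\<close>

definition cyclic_mat :: "nat \<Rightarrow> nat \<Rightarrow> 'a::comm_ring_1 \<Rightarrow> 'a mat" where
  "cyclic_mat q a w = mat (q * a) (q * a) (\<lambda>(i, j).
     if Suc i < q * a then (if j = Suc i then 1 else 0)
     else if q dvd j then - ((-1) ^ (a - j div q) * of_nat (a choose (j div q)) * w ^ (a - j div q))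
     else 0)"

lemma cyclic_mat_carrier: "cyclic_mat q a w \<in> carrier_mat (q * a) (q * a)"
  by (simp add: cyclic_mat_def)

lemma (in comm_ring_hom) map_cyclic_mat: "map_mat hom (cyclic_mat q a w) = cyclic_mat q a (hom w)"
  by (rule eq_matI) (auto simp: cyclic_mat_def hom_distribs)

text \<open>Compare the coefficients of T^j in T^(q a) = ((1 + T)^q - 1)^a. The left one vanishes
  since j < q a, and the term b = a is moved to the other side. This is the relation recorded in the
  last row of \<open>cyclic_mat\<close> at w = 1.\<close>

lemma binomial_cyclic_relation:
  assumes "prime CHAR('a::comm_ring_1)" "q = CHAR('a) ^ r" and j: "j < q * a"
  shows "of_nat (q * a choose j) =
    (\<Sum>b<a. - ((-1) ^ (a - b) * of_nat (a choose b)) * (of_nat (q * b choose j) :: 'a))"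
proof -
  let ?T = "[:1, 1:] :: 'a poly"
  have "?T - 1 = [:0, 1:]" by (simp add: one_pCons)
  hence "[:0, 1:] ^ q = ?T ^ q - 1"
    using power_prime_power_minus_one[of q r ?T] assms CHAR_poly[OF assms(1)] by simp
  hence "monom 1 (q * a) = (?T ^ q + (-1)) ^ a" by (simp add: monom_altdef power_mult)
  also have "\<dots> = (\<Sum>b\<le>a. of_nat (a choose b) * (?T ^ q) ^ b * (-1) ^ (a - b))"
    by (rule binomial_ring)
  also have "\<dots> = (\<Sum>b\<le>a. Polynomial.smult ((-1) ^ (a - b) * of_nat (a choose b)) (?T ^ (q * b)))"
  proof (intro sum.cong refl)
    fix b
    have "of_nat (a choose b) * (?T ^ q) ^ b * (-1) ^ (a - b) = [:(-1) ^ (a - b) * of_nat (a choose b):] * ?T ^ (q * b)"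
      by (cases "even (a - b)") (simp_all add: power_mult of_nat_poly)
    thus "of_nat (a choose b) * (?T ^ q) ^ b * (-1) ^ (a - b) =
      Polynomial.smult ((-1) ^ (a - b) * of_nat (a choose b)) (?T ^ (q * b))" by simp
  qed
  finally have "coeff (monom 1 (q * a)) j =
    (\<Sum>b\<le>a. (-1) ^ (a - b) * of_nat (a choose b) * coeff (?T ^ (q * b)) j)"
    by (simp add: coeff_sum)
  moreover have "coeff (?T ^ k) j = of_nat (k choose j)" for k
  proof (cases "j \<le> k")
    case False
    thus ?thesis using degree_power_le[of ?T k] by (simp add: coeff_eq_0 binomial_eq_0)
  qed (simp add: coeff_linear_poly_power)
  ultimately have "0 = (\<Sum>b\<le>a. (-1) ^ (a - b) * of_nat (a choose b) * (of_nat (q * b choose j) :: 'a))"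
    using j by simp
  also have "{..a} = insert a {..<a}" by auto
  finally show ?thesis by (simp add: sum_negf add_eq_0_iff2)
qed

text \<open>At w = 1 the modulus is (T^q - 1)^a = (T - 1)^(q a). \<open>E\<close> expresses the
  powers T^i in the basis (T - 1)^j, in which multiplication by T is a Jordan block. Rows other than
  the last match by Pascal's rule, the last one by \<open>binomial_cyclic_relation\<close>.\<close>

lemma similar_cyclic_mat_jordan_block:
  assumes "prime CHAR('a::field)" "q = CHAR('a) ^ r"
  shows "similar_mat (cyclic_mat q a (1::'a)) (jordan_block (q * a) 1)"
proof -
  have q: "q > 0" using assms prime_gt_0_nat by simp
  define m where "m = q * a"
  define E where "E = mat m m (\<lambda>(i, j). of_nat (i choose j) :: 'a)"
  have E: "E \<in> carrier_mat m m" by (simp add: E_def)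
  have C: "cyclic_mat q a (1::'a) \<in> carrier_mat m m" by (simp add: cyclic_mat_def m_def)
  have "det E = prod_list (diag_mat E)"
    by (rule det_lower_triangular[OF _ E]) (simp add: E_def binomial_eq_0)
  hence dE: "det E \<noteq> 0" by (auto simp: prod_list_zero_iff diag_mat_def E_def)
  have "E * jordan_block m 1 = cyclic_mat q a 1 * E"
  proof (rule eq_matI)
    fix i j assume "i < dim_row (cyclic_mat q a (1::'a) * E)" "j < dim_col (cyclic_mat q a (1::'a) * E)"
    hence ij: "i < m" "j < m" using C E by auto
    have "(E * jordan_block m 1) $$ (i, j) =
      (\<Sum>l\<in>{0..<m}. of_nat (i choose l) * (if l = j then 1 else if Suc l = j then 1 else 0))"
      using ij by (auto simp: E_def scalar_prod_def intro!: sum.cong)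
    also have "\<dots> = (\<Sum>l\<in>{0..<m}. (if l = j then of_nat (i choose j) else 0) +
       (if l = j - 1 then (if j = 0 then 0 else of_nat (i choose (j - 1))) else 0))"
      by (intro sum.cong) auto
    also have "\<dots> = of_nat (Suc i choose j)"
      using ij by (cases j) (auto simp: sum.distrib)
    finally have L: "(E * jordan_block m 1) $$ (i, j) = of_nat (Suc i choose j)" .
    have R: "(cyclic_mat q a 1 * E) $$ (i, j) = (\<Sum>l\<in>{0..<m}. cyclic_mat q a 1 $$ (i, l) * of_nat (l choose j))"
      using ij C by (auto simp: E_def scalar_prod_def intro!: sum.cong)
    show "(E * jordan_block m 1) $$ (i, j) = (cyclic_mat q a 1 * E) $$ (i, j)"
    proof (cases "Suc i < m")
      case True
      have "(\<Sum>l\<in>{0..<m}. cyclic_mat q a 1 $$ (i, l) * of_nat (l choose j)) =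
        (\<Sum>l\<in>{0..<m}. if l = Suc i then of_nat (Suc i choose j) else (0::'a))"
        using True ij by (intro sum.cong) (auto simp: cyclic_mat_def m_def)
      thus ?thesis using L R True by simp
    next
      case False
      hence i: "Suc i = m" using ij by simp
      let ?c = "\<lambda>b. - ((-1) ^ (a - b) * of_nat (a choose b)) :: 'a"
      have "(\<Sum>l\<in>{0..<m}. cyclic_mat q a 1 $$ (i, l) * of_nat (l choose j)) =
        (\<Sum>l\<in>{0..<m}. if q dvd l then ?c (l div q) * of_nat (l choose j) else 0)"
        using ij i by (intro sum.cong) (auto simp: cyclic_mat_def m_def)
      also have "\<dots> = (\<Sum>l\<in>(\<lambda>b. q * b) ` {..<a}. ?c (l div q) * of_nat (l choose j))"
        by (intro sum.mono_neutral_cong_right) (use q in \<open>auto simp: m_def elim!: dvdE\<close>)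
      also have "\<dots> = (\<Sum>b<a. ?c b * of_nat (q * b choose j))"
        using q by (subst sum.reindex) (auto simp: inj_on_def)
      also have "\<dots> = of_nat (m choose j)"
        unfolding m_def by (rule binomial_cyclic_relation[OF assms, symmetric]) (use ij m_def in simp)
      finally show ?thesis using L R i by simp
    qed
  qed (use C E in auto)
  thus ?thesis using similar_mat_if_intertwined[OF _ C E dE] by (simp add: m_def)
qed

text \<open>The substitution of T / s for T turns (T^q - 1)^a into (T^q - s^q)^a up to a scalar. On
  the power bases this is conjugation by the diagonal matrix \<open>D\<close>.\<close>

lemma similar_cyclic_mat_scale:
  fixes s :: "'a::field"
  assumes s: "s \<noteq> 0" and q: "q > 0"
  shows "similar_mat (inverse s \<cdot>\<^sub>m cyclic_mat q a (s ^ q)) (cyclic_mat q a 1)"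
proof -
  define m where "m = q * a"
  define D where "D = mat m m (\<lambda>(i, j). if i = j then s ^ i else 0)"
  have D: "D \<in> carrier_mat m m" by (simp add: D_def)
  have C: "cyclic_mat q a w \<in> carrier_mat m m" for w :: 'a by (simp add: cyclic_mat_def m_def)
  have "det D = prod_list (diag_mat D)"
    by (rule det_lower_triangular[OF _ D]) (simp add: D_def)
  hence dD: "det D \<noteq> 0" using s by (auto simp: prod_list_zero_iff diag_mat_def D_def)
  have "D * cyclic_mat q a 1 = (inverse s \<cdot>\<^sub>m cyclic_mat q a (s ^ q)) * D"
  proof (rule eq_matI)
    fix i j assume "i < dim_row ((inverse s \<cdot>\<^sub>m cyclic_mat q a (s ^ q)) * D)"
      "j < dim_col ((inverse s \<cdot>\<^sub>m cyclic_mat q a (s ^ q)) * D)"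
    hence ij: "i < m" "j < m" using C[of "s ^ q"] D by auto
    have L: "(D * cyclic_mat q a 1) $$ (i, j) = s ^ i * cyclic_mat q a 1 $$ (i, j)"
      using ij C[of 1]
      by (simp add: D_def scalar_prod_def if_distrib[of "\<lambda>x. x * _"] sum.delta cong: if_cong)
    have R: "((inverse s \<cdot>\<^sub>m cyclic_mat q a (s ^ q)) * D) $$ (i, j) =
        inverse s * cyclic_mat q a (s ^ q) $$ (i, j) * s ^ j"
      using ij C[of "s ^ q"]
      by (simp add: D_def scalar_prod_def if_distrib[of "\<lambda>x. _ * x"] sum.delta cong: if_cong)
    show "(D * cyclic_mat q a 1) $$ (i, j) = ((inverse s \<cdot>\<^sub>m cyclic_mat q a (s ^ q)) * D) $$ (i, j)"
    proof (cases "Suc i < m \<or> \<not> q dvd j")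
      case True
      thus ?thesis unfolding L R using s ij by (auto simp: cyclic_mat_def m_def)
    next
      case False
      then obtain b where b: "j = q * b" by auto
      have "b < a" using ij b by (simp add: m_def)
      \<comment> \<open>In the last row the scaling exponent i - j is q (a - b) - 1; the missing
        factor s is the prefactor \<open>inverse s\<close>.\<close>
      have "Suc i = q * (a - b) + j"
        using False ij \<open>b < a\<close> by (simp add: m_def b flip: distrib_left)
      hence "s ^ Suc i = (s ^ q) ^ (a - b) * s ^ j" by (simp only: power_add power_mult)
      hence "s ^ i = inverse s * ((s ^ q) ^ (a - b) * s ^ j)" using s by (simp add: field_simps)
      thus ?thesis unfolding L R using False ij b q by (simp add: cyclic_mat_def m_def)
    qed
  qed (use C[of 1] C[of "s ^ q"] D in auto)
  thus ?thesis using similar_mat_if_intertwined[OF C _ D dD, of "inverse s \<cdot>\<^sub>m cyclic_mat q a (s ^ q)"] C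
    by simp
qed

text \<open>Taking w to be the indeterminate of a polynomial ring gives one matrix \<open>B\<close>
  that serves all s, so that s enters only through \<open>s ^ q\<close> and the scalar
  \<open>inverse s\<close>.\<close>

lemma jordan_type_cyclic_family:
  assumes "prime CHAR('a::field)" "q = CHAR('a) ^ r" and "\<forall>m \<in> set ms. q dvd m"
  shows "\<exists>B \<in> carrier_mat (sum_list ms) (sum_list ms). \<forall>s. s \<noteq> 0 \<longrightarrow>
    similar_mat (inverse s \<cdot>\<^sub>m map_mat (\<lambda>f. poly f (s ^ q)) B) (jordan_type ms (1::'a))"
  using assms(3)
proof (induction ms)
  case Nil
  have "jordan_matrix [] = (0\<^sub>m 0 0 :: 'a mat)" by (simp add: jordan_matrix_def)
  moreover have "inverse s \<cdot>\<^sub>m map_mat (\<lambda>f. poly f (s ^ q)) (0\<^sub>m 0 0) = (0\<^sub>m 0 0 :: 'a mat)" for s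
    by (rule eq_matI) auto
  ultimately show ?case by (intro bexI[of _ "0\<^sub>m 0 0"]) (auto intro: similar_mat_refl[of _ 0])
next
  case (Cons m ms)
  have q: "q > 0" using assms prime_gt_0_nat by simp
  from Cons.prems obtain a where m: "m = q * a" by auto
  from Cons obtain B where B: "B \<in> carrier_mat (sum_list ms) (sum_list ms)"
    "\<And>s. s \<noteq> 0 \<Longrightarrow> similar_mat (inverse s \<cdot>\<^sub>m map_mat (\<lambda>f. poly f (s ^ q)) B) (jordan_type ms (1::'a))" by auto
  let ?C = "cyclic_mat q a [:0, 1:] :: 'a poly mat"
  let ?B = "four_block_mat ?C (0\<^sub>m m (sum_list ms)) (0\<^sub>m (sum_list ms) m) B"
  have C: "cyclic_mat q a w \<in> carrier_mat m m" for w :: "'b::comm_ring_1"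
    using cyclic_mat_carrier m by blast
  show ?case
  proof (intro bexI[of _ ?B] allI impI)
    fix s :: 'a assume s: "s \<noteq> 0"
    have hom: "comm_ring_hom (\<lambda>f. poly f (s ^ q))" by unfold_locales auto
    have "map_mat (\<lambda>f. poly f (s ^ q)) ?C = cyclic_mat q a (s ^ q)"
      using comm_ring_hom.map_cyclic_mat[OF hom] by simp
    moreover have zero: "inverse s \<cdot>\<^sub>m map_mat (\<lambda>f. poly f (s ^ q)) (0\<^sub>m x y) = 0\<^sub>m x y" for x y
      by (rule eq_matI) auto
    moreover have "map_mat (\<lambda>f. poly f (s ^ q)) ?C \<in> carrier_mat m m"
      "map_mat (\<lambda>f. poly f (s ^ q)) B \<in> carrier_mat (sum_list ms) (sum_list ms)"
      using C[of "[:0, 1:] :: 'a poly"] B by simp_all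
    ultimately have eq: "inverse s \<cdot>\<^sub>m map_mat (\<lambda>f. poly f (s ^ q)) ?B = four_block_mat
      (inverse s \<cdot>\<^sub>m cyclic_mat q a (s ^ q)) (0\<^sub>m m (sum_list ms)) (0\<^sub>m (sum_list ms) m)
      (inverse s \<cdot>\<^sub>m map_mat (\<lambda>f. poly f (s ^ q)) B)"
      using map_four_block_mat[OF C[of "[:0, 1:]"] zero_carrier_mat zero_carrier_mat B(1),
          where f = "\<lambda>f. poly f (s ^ q)"]
      by (simp add: smult_four_block_mat[of _ m m _ "sum_list ms" _ "sum_list ms"])
    have "similar_mat (inverse s \<cdot>\<^sub>m cyclic_mat q a (s ^ q)) (jordan_block m 1)"
      unfolding m
      by (rule similar_mat_trans[OF similar_cyclic_mat_scale[OF s q] similar_cyclic_mat_jordan_block[OF assms(1,2)]])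
    thus "similar_mat (inverse s \<cdot>\<^sub>m map_mat (\<lambda>f. poly f (s ^ q)) ?B) (jordan_type (m # ms) 1)"
      unfolding eq jordan_type_Cons
      by (rule similar_mat_four_block_0_0[OF _ B(2)[OF s]]) (use C[of "s ^ q"] B in auto)
  qed (use C[of "[:0, 1:] :: 'a poly"] B in auto)
qed

section \<open>The coordinate ring of matrix space\<close>

lemma mat_ring_simps [simp]:
  "mult (mat_ring n) = (*)" "one (mat_ring n) = 1" "zero (mat_ring n) = 0" "add (mat_ring n) = (+)"
  by (simp_all add: mat_ring_def)

abbreviation entry_polys :: "nat \<Rightarrow> 'a::comm_ring_1 entry_poly set" where
  "entry_polys n \<equiv> carrier (mat_ring n)"

lemma entry_polys_iff:
  "f \<in> entry_polys n \<longleftrightarrow> (\<forall>m \<in> Poly_Mapping.keys f. Poly_Mapping.keys m \<subseteq> {..<n} \<times> {..<n})"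
  by (simp add: mat_ring_def)

lemma entry_polysD:
  assumes "f \<in> entry_polys n" "m \<in> Poly_Mapping.keys f" "(i, j) \<in> Poly_Mapping.keys m"
  shows "i < n" "j < n"
  using assms by (auto simp: entry_polys_iff)

lemma entry_polys_0 [simp]: "0 \<in> entry_polys n" by (simp add: entry_polys_iff)
lemma entry_polys_1 [simp]: "1 \<in> entry_polys n" by (simp add: entry_polys_iff)
lemma entry_polys_const [simp]: "const_poly c \<in> entry_polys n"
  by (simp add: entry_polys_iff const_poly_def)

lemma entry_polys_single:
  "Poly_Mapping.keys m \<subseteq> {..<n} \<times> {..<n} \<Longrightarrow> Poly_Mapping.single m c \<in> entry_polys n"
  by (simp add: entry_polys_iff)

lemma entry_polys_add [simp]: "f \<in> entry_polys n \<Longrightarrow> g \<in> entry_polys n \<Longrightarrow> f + g \<in> entry_polys n"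
  using Poly_Mapping.keys_add[of f g] by (auto simp: entry_polys_iff)

lemma entry_polys_uminus [simp]: "f \<in> entry_polys n \<Longrightarrow> - f \<in> entry_polys n"
  by (simp add: entry_polys_iff in_keys_iff)

lemma entry_polys_diff [simp]: "f \<in> entry_polys n \<Longrightarrow> g \<in> entry_polys n \<Longrightarrow> f - g \<in> entry_polys n"
  using entry_polys_add[of f n "- g"] by simp

lemma entry_polys_mult [simp]:
  assumes "f \<in> entry_polys n" "g \<in> entry_polys n"
  shows "f * g \<in> entry_polys n"
  unfolding entry_polys_iff
proof
  fix m assume "m \<in> Poly_Mapping.keys (f * g)"
  then obtain a b where "m = a + b" "a \<in> Poly_Mapping.keys f" "b \<in> Poly_Mapping.keys g"
    using keys_mult[of f g] by auto
  thus "Poly_Mapping.keys m \<subseteq> {..<n} \<times> {..<n}"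
    using Poly_Mapping.keys_add[of a b] assms unfolding entry_polys_iff by blast
qed

lemma entry_polys_sum: "(\<And>i. i \<in> I \<Longrightarrow> f i \<in> entry_polys n) \<Longrightarrow> sum f I \<in> entry_polys n"
  by (induction I rule: infinite_finite_induct) auto

lemma entry_polys_prod: "(\<And>i. i \<in> I \<Longrightarrow> f i \<in> entry_polys n) \<Longrightarrow> prod f I \<in> entry_polys n"
  by (induction I rule: infinite_finite_induct) auto

lemma entry_polys_det:
  assumes "M \<in> carrier_mat s s" "\<And>i j. i < s \<Longrightarrow> j < s \<Longrightarrow> M $$ (i, j) \<in> entry_polys n"
  shows "det M \<in> entry_polys n"
proof -
  have "signof p * (\<Prod>i = 0..<s. M $$ (i, p i)) \<in> entry_polys n" if "p permutes {0..<s}" for p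
  proof -
    have "(\<Prod>i = 0..<s. M $$ (i, p i)) \<in> entry_polys n"
      using assms(2) permutes_in_image[OF that] by (intro entry_polys_prod) auto
    thus ?thesis by (cases rule: sign_cases[of p]) simp_all
  qed
  thus ?thesis unfolding det_def'[OF assms(1)] by (intro entry_polys_sum) auto
qed

lemma cring_mat_ring: "cring (mat_ring n :: 'a::comm_ring_1 entry_poly ring)"
proof (rule cringI)
  show "abelian_group (mat_ring n :: 'a entry_poly ring)"
  proof (rule abelian_groupI, simp_all add: add.assoc add.commute)
    fix f :: "'a entry_poly" assume "f \<in> entry_polys n"
    thus "\<exists>g \<in> entry_polys n. f + g = 0" by (intro bexI[of _ "- f"]) auto
  qed
  show "comm_monoid (mat_ring n :: 'a entry_poly ring)"
    by (rule comm_monoidI) (simp_all add: mult.assoc mult.commute)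
qed (simp add: distrib_right)

lemma mat_ring_minus [simp]:
  assumes "f \<in> entry_polys n" shows "\<ominus>\<^bsub>mat_ring n\<^esub> f = - f"
proof -
  interpret cring "mat_ring n" by (rule cring_mat_ring)
  show ?thesis using assms by (intro minus_equality) auto
qed

lemma ideal_mat_ringI:
  fixes I :: "'a::comm_ring_1 entry_poly set"
  assumes "I \<subseteq> entry_polys n" "0 \<in> I" and add: "\<And>f g. f \<in> I \<Longrightarrow> g \<in> I \<Longrightarrow> f + g \<in> I"
    and mult: "\<And>f g. f \<in> I \<Longrightarrow> g \<in> entry_polys n \<Longrightarrow> g * f \<in> I"
  shows "ideal I (mat_ring n)"
proof -
  interpret cring "mat_ring n :: 'a entry_poly ring" by (rule cring_mat_ring)
  have minus: "- f \<in> I" if "f \<in> I" for f using mult[OF that, of "- 1"] by simp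
  show ?thesis
  proof (rule idealI)
    show "subgroup I (add_monoid (mat_ring n))"
    proof (rule add.subgroupI)
      fix f assume f: "f \<in> I"
      hence "\<ominus>\<^bsub>mat_ring n\<^esub> f = - f" using assms(1) by (intro mat_ring_minus) auto
      thus "\<ominus>\<^bsub>mat_ring n\<^esub> f \<in> I" using minus[OF f] by simp
    qed (use assms in auto)
  qed (use mult in \<open>auto simp: mult.commute intro: ring_axioms\<close>)
qed

lemma ideal_mat_ringD:
  fixes I :: "'a::comm_ring_1 entry_poly set"
  assumes "ideal I (mat_ring n)"
  shows "I \<subseteq> entry_polys n" "0 \<in> I" "f \<in> I \<Longrightarrow> g \<in> I \<Longrightarrow> f + g \<in> I"
    "f \<in> I \<Longrightarrow> g \<in> entry_polys n \<Longrightarrow> g * f \<in> I" "f \<in> I \<Longrightarrow> g \<in> I \<Longrightarrow> f - g \<in> I"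
proof -
  interpret ideal I "mat_ring n :: 'a entry_poly ring" by fact
  show sub: "I \<subseteq> entry_polys n" using a_subset .
  show "0 \<in> I" using additive_subgroup.zero_closed[OF additive_subgroup_axioms] by simp
  show add: "f \<in> I \<Longrightarrow> g \<in> I \<Longrightarrow> f + g \<in> I" for f g
    using additive_subgroup.a_closed[OF additive_subgroup_axioms, of f g] by simp
  show mult: "f \<in> I \<Longrightarrow> g \<in> entry_polys n \<Longrightarrow> g * f \<in> I" for f g using I_l_closed[of f g] by simp
  show "f - g \<in> I" if "f \<in> I" "g \<in> I" using add[OF that(1) mult[OF that(2), of "- 1"]] by simp
qed

lemma ideal_mat_ring_sum:
  assumes "ideal I (mat_ring n)" "\<And>i. i \<in> S \<Longrightarrow> f i \<in> I"
  shows "sum f S \<in> I"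
  using assms(2) by (induction S rule: infinite_finite_induct) (auto simp: ideal_mat_ringD[OF assms(1)])

text \<open>Zorn's lemma for the ideals above \<open>L\<close> without \<one>; a maximal one is a
  maximal ideal, hence prime.\<close>

lemma (in cring) exists_primeideal_above:
  assumes L: "ideal L R" and one: "\<one> \<notin> L"
  shows "\<exists>P. primeideal P R \<and> L \<subseteq> P"
proof -
  define \<A> where "\<A> = {I. ideal I R \<and> L \<subseteq> I \<and> \<one> \<notin> I}"
  have "\<exists>M\<in>\<A>. \<forall>X\<in>\<A>. M \<subseteq> X \<longrightarrow> X = M"
  proof (rule subset_Zorn_nonempty)
    show "\<A> \<noteq> {}" using L one by (auto simp: \<A>_def)
  next
    fix \<C> assume ne: "\<C> \<noteq> {}" and ch: "subset.chain \<A> \<C>"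
    hence sub: "\<C> \<subseteq> \<A>" and tot: "\<And>I J. I \<in> \<C> \<Longrightarrow> J \<in> \<C> \<Longrightarrow> I \<subseteq> J \<or> J \<subseteq> I"
      by (auto simp: subset.chain_def)
    have id: "ideal I R" if "I \<in> \<C>" for I using that sub by (auto simp: \<A>_def)
    have add: "additive_subgroup I R" if "I \<in> \<C>" for I using ideal.axioms(1)[OF id[OF that]] .
    note closed = additive_subgroup.a_subset[OF add] additive_subgroup.zero_closed[OF add]
      additive_subgroup.a_inv_closed[OF add] additive_subgroup.a_closed[OF add]
      ideal.I_l_closed[OF id] ideal.I_r_closed[OF id]
    have "ideal (\<Union>\<C>) R"
    proof (rule idealI)
      show "subgroup (\<Union>\<C>) (add_monoid R)"
      proof (rule add.subgroupI)
        show "\<Union>\<C> \<subseteq> carrier R" using closed(1) by (rule Union_least)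
        show "\<Union>\<C> \<noteq> {}" using ne closed(2) by (auto simp: ex_in_conv[symmetric])
      next
        fix a assume "a \<in> \<Union>\<C>"
        then obtain I where "I \<in> \<C>" "a \<in> I" by auto
        thus "\<ominus> a \<in> \<Union>\<C>" using closed(3)[of I a] by auto
      next
        fix a b assume "a \<in> \<Union>\<C>" "b \<in> \<Union>\<C>"
        then obtain I J where IJ: "I \<in> \<C>" "J \<in> \<C>" "a \<in> I" "b \<in> J" by auto
        then obtain K where "K \<in> \<C>" "a \<in> K" "b \<in> K" using tot[of I J] by blast
        thus "a \<oplus> b \<in> \<Union>\<C>" using closed(4)[of K a b] by auto
      qed
    next
      fix a x assume "a \<in> \<Union>\<C>" and x: "x \<in> carrier R"
      then obtain I where "I \<in> \<C>" "a \<in> I" by auto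
      thus "x \<otimes> a \<in> \<Union>\<C>" "a \<otimes> x \<in> \<Union>\<C>"
        using closed(5)[of I a x] closed(6)[of I a x] x by auto
    qed (rule ring_axioms)
    moreover have "L \<subseteq> \<Union>\<C>" "\<one> \<notin> \<Union>\<C>" using ne sub by (auto simp: \<A>_def)
    ultimately show "\<Union>\<C> \<in> \<A>" by (simp add: \<A>_def)
  qed
  then obtain M where M: "M \<in> \<A>" and max: "\<And>X. X \<in> \<A> \<Longrightarrow> M \<subseteq> X \<Longrightarrow> X = M" by blast
  have "maximalideal M R"
  proof (rule maximalidealI)
    show "ideal M R" using M by (simp add: \<A>_def)
    show "carrier R \<noteq> M" using M by (auto simp: \<A>_def)
    fix J assume J: "ideal J R" "M \<subseteq> J" "J \<subseteq> carrier R"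
    show "J = M \<or> J = carrier R"
    proof (cases "\<one> \<in> J")
      case True
      thus ?thesis using ideal.one_imp_carrier[OF J(1)] by simp
    next
      case False
      thus ?thesis using max[of J] J M by (auto simp: \<A>_def)
    qed
  qed
  thus ?thesis using maximalideal_prime M by (auto simp: \<A>_def)
qed

section \<open>Evaluation\<close>

definition monom_eval :: "'b::comm_ring_1 mat \<Rightarrow> ((nat \<times> nat) \<Rightarrow>\<^sub>0 nat) \<Rightarrow> 'b" where
  "monom_eval A m = (\<Prod>v \<in> Poly_Mapping.keys m. (A $$ v) ^ Poly_Mapping.lookup m v)"

lemma eval_poly_at_altdef:
  "eval_poly_at \<phi> A f = (\<Sum>m \<in> Poly_Mapping.keys f. \<phi> (Poly_Mapping.lookup f m) * monom_eval A m)"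
  by (simp add: eval_poly_at_def monom_eval_def)

lemma monom_eval_superset:
  assumes "finite V" "Poly_Mapping.keys m \<subseteq> V"
  shows "monom_eval A m = (\<Prod>v \<in> V. (A $$ v) ^ Poly_Mapping.lookup m v)"
  unfolding monom_eval_def using assms by (intro prod.mono_neutral_left) (auto simp: in_keys_iff)

lemma monom_eval_add: "monom_eval A (m + m') = monom_eval A m * monom_eval A m'"
proof -
  let ?V = "Poly_Mapping.keys m \<union> Poly_Mapping.keys m'"
  have "monom_eval A (m + m') = (\<Prod>v \<in> ?V. (A $$ v) ^ Poly_Mapping.lookup (m + m') v)"
    by (rule monom_eval_superset) (use Poly_Mapping.keys_add[of m m'] in auto)
  also have "\<dots> = monom_eval A m * monom_eval A m'"
    by (subst (1 2) monom_eval_superset[of ?V]) (auto simp: lookup_add power_add prod.distrib)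
  finally show ?thesis .
qed

lemma monom_eval_0 [simp]: "monom_eval A 0 = 1" by (simp add: monom_eval_def)

lemma monom_eval_single [simp]: "monom_eval A (Poly_Mapping.single v 1) = A $$ v"
  by (simp add: monom_eval_def)

lemma entry_poly_induct [case_names zero single add]:
  assumes "P 0" "\<And>m c. P (Poly_Mapping.single m c)" "\<And>f g. P f \<Longrightarrow> P g \<Longrightarrow> P (f + g)"
  shows "P (f :: 'a::comm_ring_1 entry_poly)"
proof (induction f rule: Poly_Mapping.update_induct)
  case (update f a b)
  have "Poly_Mapping.update a b f = f + Poly_Mapping.single a b"
    by (rule poly_mapping_eqI)
       (use update(1) in \<open>auto simp: lookup_update lookup_add lookup_single in_keys_iff when_def\<close>)
  thus ?case using assms update by simp
qed (rule assms)

context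
  fixes \<phi> :: "'a::comm_ring_1 \<Rightarrow> 'b::comm_ring_1"
  assumes \<phi>: "comm_ring_hom \<phi>"
begin

interpretation \<phi>: comm_ring_hom \<phi> by (rule \<phi>)

lemma eval_poly_at_add: "eval_poly_at \<phi> A (f + g) = eval_poly_at \<phi> A f + eval_poly_at \<phi> A g"
  unfolding eval_poly_at_altdef
  by (rule setsum_keys_plus_distrib) (auto simp: \<phi>.hom_add distrib_right)

lemma eval_poly_at_single: "eval_poly_at \<phi> A (Poly_Mapping.single m c) = \<phi> c * monom_eval A m"
  by (simp add: eval_poly_at_altdef)

lemma comm_ring_hom_eval_poly_at: "comm_ring_hom (eval_poly_at \<phi> A)"
proof
  show zero: "eval_poly_at \<phi> A 0 = 0" by (simp add: eval_poly_at_altdef)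
  show "eval_poly_at \<phi> A 1 = 1" by (simp add: eval_poly_at_altdef lookup_one)
  fix f g
  show "eval_poly_at \<phi> A (f + g) = eval_poly_at \<phi> A f + eval_poly_at \<phi> A g"
    by (rule eval_poly_at_add)
  show "eval_poly_at \<phi> A (f * g) = eval_poly_at \<phi> A f * eval_poly_at \<phi> A g"
  proof (induction f rule: entry_poly_induct)
    case (single m c)
    show ?case
    proof (induction g rule: entry_poly_induct)
      case (single m' c')
      show ?case by (simp add: mult_single eval_poly_at_single \<phi>.hom_mult monom_eval_add)
    qed (simp_all add: zero distrib_left eval_poly_at_add)
  qed (simp_all add: zero distrib_right eval_poly_at_add)
qed

lemma eval_poly_at_const [simp]: "eval_poly_at \<phi> A (const_poly c) = \<phi> c"
  by (simp add: const_poly_def eval_poly_at_single)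

lemma map_eval_generic_mat:
  assumes "A \<in> carrier_mat n n"
  shows "map_mat (eval_poly_at \<phi> A) (generic_mat n) = A"
  by (rule eq_matI) (use assms in \<open>auto simp: generic_mat_def eval_poly_at_single simp del: One_nat_def\<close>)

lemma map_eval_const_mat: "map_mat (eval_poly_at \<phi> A) (map_mat const_poly Z) = map_mat \<phi> Z"
  by (rule eq_matI) auto

end

lemma comm_ring_hom_const_poly: "comm_ring_hom const_poly"
  by unfold_locales (auto simp: const_poly_def single_add mult_single)

lemma comm_ring_hom_id: "comm_ring_hom (id :: 'a::comm_ring_1 \<Rightarrow> 'a)"
  by unfold_locales auto

lemma eval_poly_at_map:
  assumes "comm_ring_hom \<phi>"
  shows "eval_poly_at id A (Poly_Mapping.map \<phi> f) = eval_poly_at \<phi> A f"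
proof -
  interpret comm_ring_hom \<phi> by fact
  have l: "Poly_Mapping.lookup (Poly_Mapping.map \<phi> f) m = \<phi> (Poly_Mapping.lookup f m)" for m
    by (simp add: map.rep_eq when_def)
  show ?thesis unfolding eval_poly_at_altdef
    by (rule sum.mono_neutral_cong_left) (auto simp: l in_keys_iff)
qed

lemma eval_poly_at_hom:
  assumes "comm_ring_hom \<phi>" "A \<in> carrier_mat n n" "f \<in> entry_polys n"
  shows "eval_poly_at \<phi> (map_mat \<phi> A) f = \<phi> (eval_poly_at id A f)"
proof -
  interpret comm_ring_hom \<phi> by fact
  have "monom_eval (map_mat \<phi> A) m = \<phi> (monom_eval A m)" if "m \<in> Poly_Mapping.keys f" for m
    unfolding monom_eval_def hom_prod
    by (rule prod.cong) (use entry_polysD[OF assms(3) that] assms(2) in \<open>auto simp: hom_power\<close>)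
  thus ?thesis unfolding eval_poly_at_altdef by (simp add: hom_sum hom_mult)
qed

section \<open>Scaling\<close>

definition mdeg :: "((nat \<times> nat) \<Rightarrow>\<^sub>0 nat) \<Rightarrow> nat" where
  "mdeg m = (\<Sum>v \<in> Poly_Mapping.keys m. Poly_Mapping.lookup m v)"

lemma single_power:
  "Poly_Mapping.single (m :: (nat \<times> nat) \<Rightarrow>\<^sub>0 nat) (c :: 'a::comm_ring_1) ^ k =
     Poly_Mapping.single (\<Sum>i<k. m) (c ^ k)"
  by (induction k) (auto simp: mult_single add.commute)

lemma prod_single:
  "(\<Prod>i\<in>S. Poly_Mapping.single (m i) (c i)) =
     Poly_Mapping.single (\<Sum>i\<in>S. m i :: (nat \<times> nat) \<Rightarrow>\<^sub>0 nat) (\<Prod>i\<in>S. c i :: 'a::comm_ring_1)"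
  by (induction S rule: infinite_finite_induct) (auto simp: mult_single)

text \<open>Written as the comorphism that \<open>translate_subscheme\<close> uses for a scalar
  matrix, so that translations unfold to it; \<open>lookup_scale_vars\<close> gives the working
  description.\<close>

definition scale_vars :: "nat \<Rightarrow> 'a::comm_ring_1 \<Rightarrow> 'a entry_poly \<Rightarrow> 'a entry_poly" where
  "scale_vars n \<zeta> = eval_poly_at const_poly (map_mat const_poly (\<zeta> \<cdot>\<^sub>m 1\<^sub>m n) * generic_mat n)"

lemma comm_ring_hom_scale_vars: "comm_ring_hom (scale_vars n \<zeta>)"
  unfolding scale_vars_def by (rule comm_ring_hom_eval_poly_at[OF comm_ring_hom_const_poly])

text \<open>Each variable goes to \<zeta> times itself, so a monomial picks up \<zeta> to its total
  degree. Variables outside the n by n range would read matrix entries out of bounds, hence the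
  assumption on \<open>f\<close>.\<close>

lemma lookup_scale_vars:
  assumes f: "f \<in> entry_polys n"
  shows "Poly_Mapping.lookup (scale_vars n \<zeta> f) m = \<zeta> ^ mdeg m * Poly_Mapping.lookup f m"
proof -
  interpret const: comm_ring_hom const_poly by (rule comm_ring_hom_const_poly)
  let ?M = "map_mat const_poly (\<zeta> \<cdot>\<^sub>m 1\<^sub>m n) * generic_mat n"
  have M: "?M $$ v = Poly_Mapping.single (Poly_Mapping.single v 1) \<zeta>" if v: "v \<in> {..<n} \<times> {..<n}" for v
  proof -
    obtain i j where ij: "v = (i, j)" "i < n" "j < n" using v by auto
    have "map_mat const_poly (\<zeta> \<cdot>\<^sub>m 1\<^sub>m n) = const_poly \<zeta> \<cdot>\<^sub>m 1\<^sub>m n"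
      by (rule eq_matI) (auto simp: const.hom_mult)
    moreover have "const_poly \<zeta> \<cdot>\<^sub>m 1\<^sub>m n * generic_mat n = const_poly \<zeta> \<cdot>\<^sub>m generic_mat n"
      by (subst mult_smult_assoc_mat[of _ n n _ n]) (auto simp: generic_mat_def)
    ultimately show ?thesis using ij by (simp add: generic_mat_def const_poly_def mult_single)
  qed
  have mono: "monom_eval ?M a = Poly_Mapping.single a (\<zeta> ^ mdeg a)" if a: "a \<in> Poly_Mapping.keys f" for a
  proof -
    have *: "(\<Sum>i<k. Poly_Mapping.single v (1::nat)) = Poly_Mapping.single v k" for k and v :: "nat \<times> nat"
      by (induction k) (auto simp: single_add[symmetric])
    have "monom_eval ?M a = (\<Prod>v \<in> Poly_Mapping.keys a.
        Poly_Mapping.single (Poly_Mapping.single v (Poly_Mapping.lookup a v)) (\<zeta> ^ Poly_Mapping.lookup a v))"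
      unfolding monom_eval_def
      by (rule prod.cong) (use M entry_polysD[OF f a] * in \<open>auto simp: single_power simp del: One_nat_def\<close>)
    also have "\<dots> = Poly_Mapping.single (\<Sum>v \<in> Poly_Mapping.keys a. Poly_Mapping.single v (Poly_Mapping.lookup a v))
        (\<zeta> ^ mdeg a)"
      by (simp add: prod_single mdeg_def power_sum)
    also have "(\<Sum>v \<in> Poly_Mapping.keys a. Poly_Mapping.single v (Poly_Mapping.lookup a v)) = a"
      by (rule poly_mapping_eqI) (auto simp: lookup_sum lookup_single when_def in_keys_iff)
    finally show ?thesis .
  qed
  have "scale_vars n \<zeta> f = (\<Sum>a\<in>Poly_Mapping.keys f. Poly_Mapping.single a (\<zeta> ^ mdeg a * Poly_Mapping.lookup f a))"
    unfolding scale_vars_def eval_poly_at_altdef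
    by (rule sum.cong) (auto simp: mono const_poly_def mult_single mult.commute)
  thus ?thesis by (auto simp: lookup_sum lookup_single when_def in_keys_iff)
qed

lemma entry_polys_scale_vars:
  assumes f: "f \<in> entry_polys n"
  shows "scale_vars n \<zeta> f \<in> entry_polys n"
  unfolding entry_polys_iff
proof
  fix m assume "m \<in> Poly_Mapping.keys (scale_vars n \<zeta> f)"
  hence "m \<in> Poly_Mapping.keys f" by (auto simp: in_keys_iff lookup_scale_vars[OF f])
  thus "Poly_Mapping.keys m \<subseteq> {..<n} \<times> {..<n}" using f by (simp add: entry_polys_iff)
qed

lemma scale_vars_scale_vars:
  assumes "f \<in> entry_polys n"
  shows "scale_vars n \<zeta> (scale_vars n \<xi> f) = scale_vars n (\<zeta> * \<xi>) f"
  by (rule poly_mapping_eqI)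
     (simp add: lookup_scale_vars entry_polys_scale_vars assms power_mult_distrib mult.assoc)

lemma scale_vars_1: "f \<in> entry_polys n \<Longrightarrow> scale_vars n 1 f = f"
  by (rule poly_mapping_eqI) (simp add: lookup_scale_vars)

lemma eval_scale_vars:
  assumes A: "A \<in> carrier_mat n n" and f: "f \<in> entry_polys n"
  shows "eval_poly_at id A (scale_vars n \<zeta> f) = eval_poly_at id (\<zeta> \<cdot>\<^sub>m A) f"
proof -
  have "monom_eval (\<zeta> \<cdot>\<^sub>m A) m = \<zeta> ^ mdeg m * monom_eval A m" if "m \<in> Poly_Mapping.keys f" for m
  proof -
    have "monom_eval (\<zeta> \<cdot>\<^sub>m A) m = (\<Prod>v\<in>Poly_Mapping.keys m. \<zeta> ^ Poly_Mapping.lookup m v * (A $$ v) ^ Poly_Mapping.lookup m v)"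
      unfolding monom_eval_def
      by (rule prod.cong) (use entry_polysD[OF f that] A in \<open>auto simp: power_mult_distrib\<close>)
    thus ?thesis by (simp add: prod.distrib monom_eval_def mdeg_def power_sum)
  qed
  hence "eval_poly_at id (\<zeta> \<cdot>\<^sub>m A) f =
      (\<Sum>m\<in>Poly_Mapping.keys f. Poly_Mapping.lookup (scale_vars n \<zeta> f) m * monom_eval A m)"
    unfolding eval_poly_at_altdef by (simp add: lookup_scale_vars[OF f] mult_ac)
  also have "\<dots> = eval_poly_at id A (scale_vars n \<zeta> f)"
    unfolding eval_poly_at_altdef id_apply
    by (rule sum.mono_neutral_right) (auto simp: in_keys_iff lookup_scale_vars[OF f])
  finally show ?thesis by simp
qed

section \<open>The centre\<close>

lemma map_const_scalar_mat: "map_mat const_poly (\<zeta> \<cdot>\<^sub>m 1\<^sub>m n) = const_poly \<zeta> \<cdot>\<^sub>m 1\<^sub>m n"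
proof -
  interpret comm_ring_hom const_poly by (rule comm_ring_hom_const_poly)
  show ?thesis by (rule eq_matI) (auto simp: hom_mult)
qed

lemma generic_mat_carrier: "generic_mat n \<in> carrier_mat n n" by (simp add: generic_mat_def)

lemma generic_mat_entry: "i < n \<Longrightarrow> j < n \<Longrightarrow> generic_mat n $$ (i, j) \<in> entry_polys n"
  by (simp add: generic_mat_def entry_polys_single)

text \<open>For c = 1 this is the kernel of evaluation. For general c it is the preimage of the
  annihilator of c, which is proper whenever c \<noteq> 0, even if there are zero divisors.\<close>

lemma ideal_eval_eq_0:
  assumes "comm_ring_hom \<phi>"
  shows "ideal {f \<in> entry_polys n. eval_poly_at \<phi> A f * c = 0} (mat_ring n)"
proof -
  interpret comm_ring_hom "eval_poly_at \<phi> A" by (rule comm_ring_hom_eval_poly_at[OF assms])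
  show ?thesis
    by (rule ideal_mat_ringI) (auto simp: hom_add hom_mult distrib_right mult.assoc)
qed

lemma genideal_mat_ring:
  fixes S :: "'a::comm_ring_1 entry_poly set"
  assumes "S \<subseteq> entry_polys n"
  shows "ideal (genideal (mat_ring n) S) (mat_ring n)" "S \<subseteq> genideal (mat_ring n) S"
proof -
  interpret cring "mat_ring n :: 'a entry_poly ring" by (rule cring_mat_ring)
  show "ideal (genideal (mat_ring n) S) (mat_ring n)" "S \<subseteq> genideal (mat_ring n) S"
    using genideal_ideal[OF assms] genideal_self[OF assms] by auto
qed

lemma genideal_mat_ring_minimal:
  fixes I :: "'a::comm_ring_1 entry_poly set"
  assumes "ideal I (mat_ring n)" "S \<subseteq> I"
  shows "genideal (mat_ring n) S \<subseteq> I"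
proof -
  interpret cring "mat_ring n :: 'a entry_poly ring" by (rule cring_mat_ring)
  show ?thesis by (rule genideal_minimal[OF assms])
qed

text \<open>Specialise the universal point: evaluation at \<open>A\<close> kills det - 1, hence the
  ideal that contains the entries of the commutator of \<open>Z\<close> with the generic
  matrix.\<close>

lemma SL_centre_commutes:
  assumes Z: "Z \<in> SL_centre n" and A: "A \<in> SL n"
  shows "Z * A = A * Z"
proof -
  have Zc: "Z \<in> carrier_mat n n" and Ac: "A \<in> carrier_mat n n" using Z A by (auto simp: SL_centre_def SL_def)
  let ?G = "generic_mat n :: 'a entry_poly mat" and ?Z = "map_mat const_poly Z"
  interpret ev: comm_ring_hom "eval_poly_at id A" by (rule comm_ring_hom_eval_poly_at[OF comm_ring_hom_id])
  have G: "?G \<in> carrier_mat n n" by (rule generic_mat_carrier)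
  have evG: "map_mat (eval_poly_at id A) ?G = A" by (rule map_eval_generic_mat[OF comm_ring_hom_id Ac])
  have evZ: "map_mat (eval_poly_at id A) ?Z = Z"
    unfolding map_eval_const_mat[OF comm_ring_hom_id] by (rule eq_matI) auto
  have det: "det ?G - 1 \<in> entry_polys n" using entry_polys_det[OF G generic_mat_entry] by simp
  have "eval_poly_at id A (det ?G - 1) = 0"
    using A by (simp add: ev.hom_minus ev.hom_det[symmetric] evG SL_def)
  hence sub: "genideal (mat_ring n) {det ?G - 1} \<subseteq> {f \<in> entry_polys n. eval_poly_at id A f * 1 = 0}"
    using det by (intro genideal_mat_ring_minimal ideal_eval_eq_0 comm_ring_hom_id) auto
  have ZG: "map_mat (eval_poly_at id A) (?Z * ?G) = Z * A"
    using Zc G evG evZ by (simp add: ev.mat_hom_mult[of _ n n _ n])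
  have GZ: "map_mat (eval_poly_at id A) (?G * ?Z) = A * Z"
    using Zc G evG evZ by (simp add: ev.mat_hom_mult[of _ n n _ n])
  show ?thesis
  proof (rule eq_matI)
    fix i j assume "i < dim_row (A * Z)" "j < dim_col (A * Z)"
    hence ij: "i < n" "j < n" using Zc Ac by auto
    hence "(?Z * ?G - ?G * ?Z) $$ (i, j) \<in> genideal (mat_ring n) {det ?G - 1}"
      using Z by (auto simp: SL_centre_def)
    hence "eval_poly_at id A ((?Z * ?G - ?G * ?Z) $$ (i, j)) = 0" using sub by auto
    moreover have "(?Z * ?G - ?G * ?Z) $$ (i, j) = (?Z * ?G) $$ (i, j) - (?G * ?Z) $$ (i, j)"
      by (rule index_minus_mat) (use ij Zc G in auto)
    moreover have "eval_poly_at id A ((?Z * ?G) $$ (i, j)) = map_mat (eval_poly_at id A) (?Z * ?G) $$ (i, j)"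
      "eval_poly_at id A ((?G * ?Z) $$ (i, j)) = map_mat (eval_poly_at id A) (?G * ?Z) $$ (i, j)"
      by (rule index_map_mat[symmetric]; use ij Zc G in auto)+
    ultimately show "(Z * A) $$ (i, j) = (A * Z) $$ (i, j)"
      unfolding ZG GZ by (simp add: ev.hom_minus)
  qed (use Zc Ac in auto)
qed

lemma SL_centre_eq:
  assumes n: "n \<ge> 1"
  shows "(SL_centre n :: 'a::comm_ring_1 mat set) = mu_scalar n n"
proof (intro equalityI subsetI)
  fix Z :: "'a mat" assume Z: "Z \<in> SL_centre n"
  hence Zc: "Z \<in> carrier_mat n n" and detZ: "det Z = 1" by (auto simp: SL_centre_def SL_def)
  \<comment> \<open>Entry (i, j) of the identity \<open>Z * E = E * Z\<close>, where E is the matrix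
    unit at (k, l) and 1 + E lies in SL. The choice i = j = l kills off-diagonal entries; i = k with
    j = l equates two diagonal ones.\<close>
  have comm: "(if j = l then Z $$ (i, k) else 0) = (if i = k then Z $$ (l, j) else 0)"
    if kl: "k < n" "l < n" "k \<noteq> l" and ij: "i < n" "j < n" for i j k l
  proof -
    let ?E = "addrow_mat n (1::'a) k l"
    have "Z * ?E = ?E * Z"
      by (rule SL_centre_commutes[OF Z]) (use det_addrow_mat[OF kl(3), of n "1::'a"] in \<open>auto simp: SL_def\<close>)
    hence "(Z * ?E) $$ (i, j) = (?E * Z) $$ (i, j)" by simp
    moreover have E: "?E $$ (x, y) = (if x = y then 1 else 0) + (if x = k \<and> y = l then 1 else 0)"
      if "x < n" "y < n" for x y using that by (auto simp: addrow_mat_def)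
    moreover have "(Z * ?E) $$ (i, j) = (\<Sum>x\<in>{0..<n}. Z $$ (i, x) * ?E $$ (x, j))"
      "(?E * Z) $$ (i, j) = (\<Sum>x\<in>{0..<n}. ?E $$ (i, x) * Z $$ (x, j))"
      using ij Zc by (simp_all add: scalar_prod_def)
    moreover have "(\<Sum>x\<in>{0..<n}. Z $$ (i, x) * ?E $$ (x, j)) = (\<Sum>x\<in>{0..<n}. (if x = j then Z $$ (i, j) else 0) +
        (if x = k then (if j = l then Z $$ (i, k) else 0) else 0))"
      by (rule sum.cong) (use ij kl E in \<open>auto simp: algebra_simps\<close>)
    moreover have "(\<Sum>x\<in>{0..<n}. ?E $$ (i, x) * Z $$ (x, j)) = (\<Sum>x\<in>{0..<n}. (if x = i then Z $$ (i, j) else 0) +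
        (if x = l then (if i = k then Z $$ (l, j) else 0) else 0))"
      by (rule sum.cong) (use ij kl E in \<open>auto simp: algebra_simps\<close>)
    ultimately show ?thesis using ij kl by (simp add: sum.distrib)
  qed
  have off: "Z $$ (i, k) = 0" if "i < n" "k < n" "i \<noteq> k" for i k
    using comm[of k i i i] comm[of k i i k] that by auto
  have diag: "Z $$ (i, i) = Z $$ (0, 0)" if "i < n" for i
    using comm[of i 0 i 0] that n by (cases "i = 0") auto
  have eq: "Z = Z $$ (0, 0) \<cdot>\<^sub>m 1\<^sub>m n"
  proof (rule eq_matI)
    fix i j assume "i < dim_row (Z $$ (0, 0) \<cdot>\<^sub>m 1\<^sub>m n)" "j < dim_col (Z $$ (0, 0) \<cdot>\<^sub>m 1\<^sub>m n)"
    thus "Z $$ (i, j) = (Z $$ (0, 0) \<cdot>\<^sub>m 1\<^sub>m n) $$ (i, j)"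
      using off[of i j] diag[of i] by (cases "i = j") simp_all
  qed (use Zc in auto)
  have "det (Z $$ (0, 0) \<cdot>\<^sub>m 1\<^sub>m n) = 1" by (subst eq[symmetric]) (rule detZ)
  hence "Z $$ (0, 0) ^ n = 1" by simp
  thus "Z \<in> mu_scalar n n" unfolding mu_scalar_def using eq by blast
next
  fix Z :: "'a mat" assume "Z \<in> mu_scalar n n"
  then obtain \<zeta> where Z: "Z = \<zeta> \<cdot>\<^sub>m 1\<^sub>m n" "\<zeta> ^ n = 1" by (auto simp: mu_scalar_def)
  let ?G = "generic_mat n :: 'a entry_poly mat"
  have G: "?G \<in> carrier_mat n n" by (rule generic_mat_carrier)
  have "map_mat const_poly Z * ?G - ?G * map_mat const_poly Z = 0\<^sub>m n n"
    unfolding Z map_const_scalar_mat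
    using G by (subst mult_smult_assoc_mat[of _ n n _ n], simp, simp,
        subst mult_smult_distrib[of _ n n _ n]) auto
  moreover have "ideal (genideal (mat_ring n) {det ?G - 1}) (mat_ring n)"
    using entry_polys_det[OF G generic_mat_entry] by (intro genideal_mat_ring) simp
  hence "0 \<in> genideal (mat_ring n) {det ?G - 1}" by (rule ideal_mat_ringD)
  ultimately show "Z \<in> SL_centre n" using Z by (auto simp: SL_centre_def SL_def)
qed

lemma mu_scalar_mono: "m dvd m' \<Longrightarrow> mu_scalar n m \<subseteq> (mu_scalar n m' :: 'a::comm_ring_1 mat set)"
  unfolding mu_scalar_def by (auto simp: power_mult elim!: dvdE)

section \<open>Translation by infinitesimal scalars\<close>

lemma primeideal_power_mem:
  fixes P :: "'a::comm_ring_1 entry_poly set"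
  assumes P: "primeideal P (mat_ring n)" and "f \<in> entry_polys n" "f ^ k \<in> P"
  shows "f \<in> P"
  using assms(3)
proof (induction k)
  case 0
  interpret primeideal P "mat_ring n" by fact
  have "\<one>\<^bsub>mat_ring n\<^esub> \<in> P" using 0 by simp
  hence "P = entry_polys n" by (rule one_imp_carrier)
  thus ?case using I_notcarr by simp
next
  case (Suc k)
  interpret primeideal P "mat_ring n" by fact
  have "f ^ k \<in> entry_polys n" using assms(2) by (induction k) auto
  thus ?case using I_prime[of f "f ^ k"] Suc assms(2) by auto
qed

lemma lookup_const_mult:
  "Poly_Mapping.lookup (const_poly c * g) m = c * Poly_Mapping.lookup g m"
  by (induction g rule: entry_poly_induct)
     (auto simp: const_poly_def mult_single lookup_single distrib_left lookup_add when_def)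

text \<open>The difference is divisible by \<zeta> - 1, with geometric sums in the quotient
  \<open>g\<close>, and \<zeta> - 1 is nilpotent.\<close>

lemma scale_vars_diff_mem_primeideal:
  fixes P :: "'a::comm_ring_1 entry_poly set"
  assumes char: "prime CHAR('a)" "q = CHAR('a) ^ r" and \<zeta>: "\<zeta> ^ q = 1"
    and P: "primeideal P (mat_ring n)" and f: "f \<in> entry_polys n"
  shows "scale_vars n \<zeta> f - f \<in> P"
proof -
  interpret const: comm_ring_hom const_poly by (rule comm_ring_hom_const_poly)
  have id: "ideal P (mat_ring n)" by (rule primeideal.axioms(1)[OF P])
  have "(\<zeta> - 1) ^ q = 0" using power_prime_power_minus_one[OF char] \<zeta> by simp
  hence "const_poly (\<zeta> - 1) ^ q = 0" by (metis const.hom_power const.hom_zero)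
  hence mem: "const_poly (\<zeta> - 1) \<in> P"
    using primeideal_power_mem[OF P, of "const_poly (\<zeta> - 1)" q] ideal_mat_ringD(2)[OF id] by simp
  define g where "g = (\<Sum>m\<in>Poly_Mapping.keys f.
      Poly_Mapping.single m ((\<Sum>i<mdeg m. \<zeta> ^ i) * Poly_Mapping.lookup f m))"
  have g: "g \<in> entry_polys n"
    unfolding g_def using f by (intro entry_polys_sum entry_polys_single) (auto simp: entry_polys_iff)
  have lg: "Poly_Mapping.lookup g m = (\<Sum>i<mdeg m. \<zeta> ^ i) * Poly_Mapping.lookup f m" for m
    by (auto simp: g_def lookup_sum lookup_single when_def in_keys_iff)
  have "scale_vars n \<zeta> f - f = const_poly (\<zeta> - 1) * g"
  proof (rule poly_mapping_eqI)
    fix m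
    have "\<zeta> ^ mdeg m - 1 = (\<zeta> - 1) * (\<Sum>i<mdeg m. \<zeta> ^ i)" by (rule power_diff_1_eq)
    moreover have "\<zeta> ^ mdeg m * Poly_Mapping.lookup f m - Poly_Mapping.lookup f m =
        (\<zeta> ^ mdeg m - 1) * Poly_Mapping.lookup f m" by (simp add: left_diff_distrib)
    ultimately show "Poly_Mapping.lookup (scale_vars n \<zeta> f - f) m = Poly_Mapping.lookup (const_poly (\<zeta> - 1) * g) m"
      by (simp only: lookup_minus lookup_scale_vars[OF f] lookup_const_mult lg mult.assoc)
  qed
  also have "\<dots> = g * const_poly (\<zeta> - 1)" by (rule mult.commute)
  also have "\<dots> \<in> P" by (rule ideal_mat_ringD(4)[OF id mem g])
  finally show ?thesis .
qed

lemma scale_vars_mem_primeideal_iff: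
  fixes P :: "'a::comm_ring_1 entry_poly set"
  assumes "prime CHAR('a)" "q = CHAR('a) ^ r" "\<zeta> ^ q = 1"
    and P: "primeideal P (mat_ring n)" and f: "f \<in> entry_polys n"
  shows "scale_vars n \<zeta> f \<in> P \<longleftrightarrow> f \<in> P"
proof -
  note D = ideal_mat_ringD[OF primeideal.axioms(1)[OF P]]
  have d: "scale_vars n \<zeta> f - f \<in> P" by (rule scale_vars_diff_mem_primeideal[OF assms])
  show ?thesis using D(3)[OF _ d, of f] D(5)[OF _ d, of "scale_vars n \<zeta> f"] by auto
qed

lemma translate_subscheme_scalar:
  "translate_subscheme n (\<zeta> \<cdot>\<^sub>m 1\<^sub>m n) Y =
     (\<lambda>(P, I). ({f \<in> entry_polys n. scale_vars n \<zeta> f \<in> P}, {f \<in> entry_polys n. scale_vars n \<zeta> f \<in> I})) ` Y"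
  by (simp add: translate_subscheme_def subscheme_image_def scale_vars_def)

text \<open>Translation fixes each prime, so only the local ideals have to be compared.
  \<open>J\<close> enters only through the choice of primes, and stability of \<open>I\<close> lets
  a denominator s be replaced by its translate, which avoids the same primes.\<close>

lemma translate_lc_subscheme_eq:
  fixes I :: "'a::comm_ring_1 entry_poly set"
  assumes char: "prime CHAR('a)" "q = CHAR('a) ^ r" and \<zeta>: "\<zeta> ^ q = 1"
    and stable: "\<And>\<xi> f. \<xi> ^ q = 1 \<Longrightarrow> f \<in> I \<Longrightarrow> scale_vars n \<xi> f \<in> I"
  shows "translate_subscheme n (\<zeta> \<cdot>\<^sub>m 1\<^sub>m n) (lc_subscheme (mat_ring n) I J) = lc_subscheme (mat_ring n) I J"
proof -
  have q: "q > 0" using char prime_gt_0_nat by simp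
  \<comment> \<open>The inverse of \<zeta>, again a q-th root of unity; it undoes the translation in
    one of the two inclusions.\<close>
  define \<xi> where "\<xi> = \<zeta> ^ (q - 1)"
  have inv: "\<xi> * \<zeta> = 1" using power_minus_mult[OF q, of \<zeta>] \<zeta> by (simp add: \<xi>_def)
  have \<xi>: "\<xi> ^ q = 1" unfolding \<xi>_def using \<zeta> by (metis mult.commute power_mult power_one)
  have "{f \<in> entry_polys n. scale_vars n \<zeta> f \<in> P} = P \<and>
      {f \<in> entry_polys n. scale_vars n \<zeta> f \<in> local_ideal (mat_ring n) I P} = local_ideal (mat_ring n) I P"
    if P: "primeideal P (mat_ring n)" for P
  proof
    note iff = scale_vars_mem_primeideal_iff[OF char _ P]
    show "{f \<in> entry_polys n. scale_vars n \<zeta> f \<in> P} = P"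
      using iff[OF \<zeta>] ideal_mat_ringD(1)[OF primeideal.axioms(1)[OF P]] by auto
    show "{f \<in> entry_polys n. scale_vars n \<zeta> f \<in> local_ideal (mat_ring n) I P} = local_ideal (mat_ring n) I P"
    proof (intro equalityI subsetI)
      fix f assume "f \<in> {f \<in> entry_polys n. scale_vars n \<zeta> f \<in> local_ideal (mat_ring n) I P}"
      then obtain s where f: "f \<in> entry_polys n" and s: "s \<in> entry_polys n" "s \<notin> P" "s * scale_vars n \<zeta> f \<in> I"
        by (auto simp: local_ideal_def)
      interpret sc: comm_ring_hom "scale_vars n \<xi>" by (rule comm_ring_hom_scale_vars)
      have "scale_vars n \<xi> s * f = scale_vars n \<xi> (s * scale_vars n \<zeta> f)"
        by (simp add: sc.hom_mult scale_vars_scale_vars f inv scale_vars_1)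
      also have "\<dots> \<in> I" by (rule stable[OF \<xi> s(3)])
      finally show "f \<in> local_ideal (mat_ring n) I P"
        using f s iff[OF \<xi> s(1)] entry_polys_scale_vars[OF s(1)] by (auto simp: local_ideal_def)
    next
      fix f assume "f \<in> local_ideal (mat_ring n) I P"
      then obtain s where f: "f \<in> entry_polys n" and s: "s \<in> entry_polys n" "s \<notin> P" "s * f \<in> I"
        by (auto simp: local_ideal_def)
      interpret sc: comm_ring_hom "scale_vars n \<zeta>" by (rule comm_ring_hom_scale_vars)
      have "scale_vars n \<zeta> s * scale_vars n \<zeta> f \<in> I"
        using stable[OF \<zeta> s(3)] by (simp add: sc.hom_mult)
      thus "f \<in> {f \<in> entry_polys n. scale_vars n \<zeta> f \<in> local_ideal (mat_ring n) I P}"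
        using f s iff[OF \<zeta> s(1)] entry_polys_scale_vars[OF s(1)] entry_polys_scale_vars[OF f]
        by (auto simp: local_ideal_def)
    qed
  qed
  hence "translate_subscheme n (\<zeta> \<cdot>\<^sub>m 1\<^sub>m n) (lc_subscheme (mat_ring n) I J) =
      (\<lambda>x. x) ` lc_subscheme (mat_ring n) I J"
    unfolding translate_subscheme_scalar by (intro image_cong) (auto simp: lc_subscheme_def)
  thus ?thesis by simp
qed

text \<open>An action of the group scheme of q-th roots of unity is a grading by the integers modulo
  q; this is the component of weight c.\<close>

definition residue_part :: "nat \<Rightarrow> nat \<Rightarrow> 'a::comm_ring_1 entry_poly \<Rightarrow> 'a entry_poly" where
  "residue_part q c f =
     (\<Sum>m \<in> {m \<in> Poly_Mapping.keys f. mdeg m mod q = c}. Poly_Mapping.single m (Poly_Mapping.lookup f m))"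

lemma lookup_residue_part:
  "Poly_Mapping.lookup (residue_part q c f) m = (if mdeg m mod q = c then Poly_Mapping.lookup f m else 0)"
  by (auto simp: residue_part_def lookup_sum lookup_single when_def in_keys_iff)

lemma entry_polys_residue_part: "f \<in> entry_polys n \<Longrightarrow> residue_part q c f \<in> entry_polys n"
  unfolding residue_part_def by (intro entry_polys_sum entry_polys_single) (auto simp: entry_polys_iff)

lemma eval_residue_part:
  "eval_poly_at id A (residue_part q c f) =
     (\<Sum>m \<in> Poly_Mapping.keys f. if mdeg m mod q = c then Poly_Mapping.lookup f m * monom_eval A m else 0)"
proof -
  have "eval_poly_at id A (residue_part q c f) = (\<Sum>m \<in> Poly_Mapping.keys f.
      Poly_Mapping.lookup (residue_part q c f) m * monom_eval A m)"
    unfolding eval_poly_at_altdef id_apply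
    by (rule sum.mono_neutral_left) (auto simp: in_keys_iff lookup_residue_part split: if_splits)
  also have "\<dots> = (\<Sum>m \<in> Poly_Mapping.keys f. if mdeg m mod q = c then Poly_Mapping.lookup f m * monom_eval A m else 0)"
    by (rule sum.cong) (auto simp: lookup_residue_part)
  finally show ?thesis .
qed

lemma lookup_map_hom:
  assumes "comm_ring_hom \<phi>"
  shows "Poly_Mapping.lookup (Poly_Mapping.map \<phi> f) m = \<phi> (Poly_Mapping.lookup f m)"
proof -
  interpret comm_ring_hom \<phi> by fact
  show ?thesis by (simp add: map.rep_eq when_def)
qed

lemma entry_polys_map:
  assumes "comm_ring_hom \<phi>" "f \<in> entry_polys n"
  shows "Poly_Mapping.map \<phi> f \<in> entry_polys n"
  unfolding entry_polys_iff
proof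
  interpret comm_ring_hom \<phi> by fact
  fix m assume "m \<in> Poly_Mapping.keys (Poly_Mapping.map \<phi> f)"
  hence "m \<in> Poly_Mapping.keys f" by (auto simp: in_keys_iff lookup_map_hom[OF assms(1)])
  thus "Poly_Mapping.keys m \<subseteq> {..<n} \<times> {..<n}" using assms(2) by (simp add: entry_polys_iff)
qed

text \<open>Since \<xi>^q = 1, scaling multiplies the component of weight c by \<xi>^c. So
  homogeneity, a property over k, gives invariance over every R: the translate of a generator is an
  R-combination of its components, which are generators again.\<close>

lemma scale_vars_extended_ideal:
  fixes \<phi> :: "'k::comm_ring_1 \<Rightarrow> 'r::comm_ring_1"
  assumes hom: "comm_ring_hom \<phi>" and I: "I \<subseteq> entry_polys n" and q: "q > 0" and \<xi>: "\<xi> ^ q = 1"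
    and graded: "\<And>f c. f \<in> I \<Longrightarrow> residue_part q c f \<in> I"
    and F: "F \<in> extended_ideal n \<phi> I"
  shows "scale_vars n \<xi> F \<in> extended_ideal n \<phi> I"
proof -
  let ?S = "Poly_Mapping.map \<phi> ` I"
  interpret hom: comm_ring_hom \<phi> by fact
  interpret sc: comm_ring_hom "scale_vars n \<xi>" by (rule comm_ring_hom_scale_vars)
  have S: "?S \<subseteq> entry_polys n" using I entry_polys_map[OF hom] by auto
  note E = genideal_mat_ring[OF S]
  note D = ideal_mat_ringD[OF E(1)]
  have "ideal {f \<in> entry_polys n. scale_vars n \<xi> f \<in> genideal (mat_ring n) ?S} (mat_ring n)"
    by (rule ideal_mat_ringI) (auto simp: sc.hom_add sc.hom_mult D entry_polys_scale_vars)
  moreover have "scale_vars n \<xi> (Poly_Mapping.map \<phi> f) \<in> genideal (mat_ring n) ?S" if f: "f \<in> I" for f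
  proof -
    have mf: "Poly_Mapping.map \<phi> f \<in> entry_polys n" using S f by auto
    have "scale_vars n \<xi> (Poly_Mapping.map \<phi> f) =
        (\<Sum>c<q. const_poly (\<xi> ^ c) * Poly_Mapping.map \<phi> (residue_part q c f))"
    proof (rule poly_mapping_eqI)
      fix m
      have "\<xi> ^ mdeg m = \<xi> ^ (q * (mdeg m div q) + mdeg m mod q)" by simp
      also have "\<dots> = \<xi> ^ (mdeg m mod q)" by (simp only: power_add power_mult \<xi> power_one mult_1)
      finally have e: "\<xi> ^ mdeg m = \<xi> ^ (mdeg m mod q)" .
      have "Poly_Mapping.lookup (\<Sum>c<q. const_poly (\<xi> ^ c) * Poly_Mapping.map \<phi> (residue_part q c f)) m =
          (\<Sum>c<q. if c = mdeg m mod q then \<xi> ^ c * \<phi> (Poly_Mapping.lookup f m) else 0)"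
        unfolding lookup_sum
        by (rule sum.cong) (auto simp: lookup_const_mult lookup_map_hom[OF hom] lookup_residue_part)
      also have "\<dots> = \<xi> ^ (mdeg m mod q) * \<phi> (Poly_Mapping.lookup f m)" using q by simp
      finally show "Poly_Mapping.lookup (scale_vars n \<xi> (Poly_Mapping.map \<phi> f)) m =
          Poly_Mapping.lookup (\<Sum>c<q. const_poly (\<xi> ^ c) * Poly_Mapping.map \<phi> (residue_part q c f)) m"
        by (simp add: lookup_scale_vars[OF mf] lookup_map_hom[OF hom] e)
    qed
    also have "\<dots> \<in> genideal (mat_ring n) ?S"
      by (intro ideal_mat_ring_sum[OF E(1)] D(4)) (use E(2) graded[OF f] in auto)
    finally show ?thesis .
  qed
  ultimately have "genideal (mat_ring n) ?S \<subseteq>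
      {f \<in> entry_polys n. scale_vars n \<xi> f \<in> genideal (mat_ring n) ?S}"
    using S by (intro genideal_mat_ring_minimal) auto
  thus ?thesis using F by (auto simp: extended_ideal_def)
qed

section \<open>Conjugacy classes of unipotent matrices\<close>

text \<open>Euclid's argument: over a finite field the product of all X - a, plus 1, has no
  root.\<close>

lemma infinite_UNIV_alg_closed: "infinite (UNIV :: 'a::alg_closed_field set)"
proof
  assume fin: "finite (UNIV :: 'a set)"
  let ?p = "(\<Prod>a\<in>UNIV. [:- a, 1:]) :: 'a poly"
  have "degree ?p = card (UNIV :: 'a set)" by (subst degree_prod_eq_sum_degree) auto
  hence "degree ?p > 0" using fin by (simp add: card_gt_0_iff)
  hence "degree (?p + 1) > 0" by (subst degree_add_eq_left) auto
  then obtain x where "poly (?p + 1) x = 0" using alg_closed_imp_poly_has_root by blast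
  moreover have "poly ?p x = 0" using fin by (auto simp: poly_prod intro: prod_zero)
  ultimately show False by simp
qed

lemma similar_matE:
  assumes "similar_mat A B" "B \<in> carrier_mat n n"
  obtains g h where "A \<in> carrier_mat n n" "g \<in> carrier_mat n n" "h \<in> carrier_mat n n"
    "g * h = 1\<^sub>m n" "h * g = 1\<^sub>m n" "A = g * B * h"
proof -
  from similar_matD[OF assms(1)] obtain n' g h where
    c: "{A, B, g, h} \<subseteq> carrier_mat n' n'" and "g * h = 1\<^sub>m n'" "h * g = 1\<^sub>m n'" "A = g * B * h" by blast
  moreover have "n' = n" using c assms(2) by (metis carrier_matD(1) insert_subset)
  ultimately show thesis by (intro that[of g h]) auto
qed

lemma conj_class_iff:
  fixes u :: "'k::alg_closed_field mat"
  assumes u: "u \<in> carrier_mat n n" and n: "n \<ge> 1"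
  shows "A \<in> conj_class n u \<longleftrightarrow> similar_mat A u"
proof
  assume "A \<in> conj_class n u"
  then obtain g h where gh: "g \<in> SL n" "h \<in> SL n" "g * h = 1\<^sub>m n" "A = g * u * h"
    by (auto simp: conj_class_def)
  hence c: "g \<in> carrier_mat n n" "h \<in> carrier_mat n n" by (auto simp: SL_def)
  have "h * g = 1\<^sub>m n" by (rule mat_mult_left_right_inverse[OF c gh(3)])
  thus "similar_mat A u" using gh c u by (intro similar_matI[of _ _ g h n]) auto
next
  assume "similar_mat A u"
  from similar_matE[OF this u] obtain g h where
    c: "A \<in> carrier_mat n n" "g \<in> carrier_mat n n" "h \<in> carrier_mat n n"
    and gh: "g * h = 1\<^sub>m n" and A: "A = g * u * h" by metis
  have "det g * det h = 1" using det_mult[OF c(2,3)] gh by simp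
  \<comment> \<open>An n-th root of det h turns conjugation by GL into conjugation by SL: c g and h
    / c have determinant 1 and conjugate in the same way.\<close>
  moreover obtain c where cn: "c ^ n = det h" using nth_root_exists[of n "det h"] n by auto
  ultimately have c0: "c \<noteq> 0" using n by (auto simp: power_0_left)
  have ss: "inverse c \<cdot>\<^sub>m (c \<cdot>\<^sub>m X) = X" for X by (rule eq_matI) (use c0 in auto)
  have "det h \<noteq> 0" using \<open>det g * det h = 1\<close> by auto
  have "det (c \<cdot>\<^sub>m g) = 1" using c cn \<open>det g * det h = 1\<close> by (simp add: mult.commute)
  moreover have "det (inverse c \<cdot>\<^sub>m h) = 1" using c cn \<open>det h \<noteq> 0\<close> by (simp add: power_inverse)
  moreover have "(c \<cdot>\<^sub>m g) * (inverse c \<cdot>\<^sub>m h) = 1\<^sub>m n"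
    using c c0 gh by (simp add: ss mult_smult_assoc_mat[of _ n n _ n] mult_smult_distrib[of _ n n _ n]) 
  moreover have "(c \<cdot>\<^sub>m g) * u * (inverse c \<cdot>\<^sub>m h) = A"
    using c c0 u A by (simp add: ss mult_smult_assoc_mat[of _ n n _ n] mult_smult_distrib[of _ n n _ n])
  moreover have "c \<cdot>\<^sub>m g \<in> carrier_mat n n" "inverse c \<cdot>\<^sub>m h \<in> carrier_mat n n" using c by auto
  ultimately show "A \<in> conj_class n u"
    unfolding conj_class_def SL_def by (metis (mono_tags, lifting) mem_Collect_eq)
qed

lemma eval_smult:
  assumes A: "A \<in> carrier_mat n n" and f: "f \<in> entry_polys n"
  shows "eval_poly_at id (\<zeta> \<cdot>\<^sub>m A) f =
    (\<Sum>m \<in> Poly_Mapping.keys f. \<zeta> ^ mdeg m * Poly_Mapping.lookup f m * monom_eval A m)"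
proof -
  have "eval_poly_at id (\<zeta> \<cdot>\<^sub>m A) f =
      (\<Sum>m \<in> Poly_Mapping.keys f. Poly_Mapping.lookup (scale_vars n \<zeta> f) m * monom_eval A m)"
    unfolding eval_scale_vars[OF A f, symmetric] eval_poly_at_altdef[of id A] id_apply
    by (rule sum.mono_neutral_left) (auto simp: in_keys_iff lookup_scale_vars[OF f])
  thus ?thesis by (simp add: lookup_scale_vars[OF f])
qed

lemma monom_eval_map:
  assumes "comm_ring_hom \<phi>" and A: "A \<in> carrier_mat n n"
    and f: "f \<in> entry_polys n" "m \<in> Poly_Mapping.keys f"
  shows "monom_eval (map_mat \<phi> A) m = \<phi> (monom_eval A m)"
proof -
  interpret comm_ring_hom \<phi> by fact
  show ?thesis unfolding monom_eval_def hom_prod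
    by (rule prod.cong) (use entry_polysD[OF f] A in \<open>auto simp: hom_power\<close>)
qed

lemma diff_mod_eq_iff:
  fixes K d c q :: nat
  assumes "d \<le> K" "c \<le> K"
  shows "(K - d) mod q = (K - c) mod q \<longleftrightarrow> d mod q = c mod q"
proof -
  have *: "(K - d) mod q = (K - c) mod q \<longleftrightarrow> d mod q = c mod q" if dc: "d \<le> c" "c \<le> K" for c d
  proof -
    have "(K - d) mod q = (K - c) mod q \<longleftrightarrow> q dvd (K - d) - (K - c)"
      by (rule mod_eq_dvd_iff_nat) (use dc in simp)
    also have "(K - d) - (K - c) = c - d" using dc by simp
    also have "q dvd c - d \<longleftrightarrow> d mod q = c mod q" using mod_eq_dvd_iff_nat[OF dc(1), of q] by metis
    finally show ?thesis .
  qed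
  show ?thesis
  proof (cases "d \<le> c")
    case True thus ?thesis using * assms by blast
  next
    case False thus ?thesis using *[of c d] assms by (metis nat_le_linear)
  qed
qed

text \<open>Multiply the vanishing values by a power of \<open>s\<close> and compare exponents of \<open>s\<close> modulo \<open>q\<close>.\<close>

lemma residue_part_vanishes:
  fixes B :: "'k::alg_closed_field poly mat"
  assumes B: "B \<in> carrier_mat n n" and f: "f \<in> entry_polys n" and q: "q > 0" and c: "c < q"
    and vanish: "\<And>s. s \<noteq> 0 \<Longrightarrow> eval_poly_at id (inverse s \<cdot>\<^sub>m map_mat (\<lambda>g. poly g (s ^ q)) B) f = 0"
  shows "eval_poly_at id (map_mat (\<lambda>g. poly g 1) B) (residue_part q c f) = 0"
proof -
  let ?K = "Poly_Mapping.keys f" and ?l = "Poly_Mapping.lookup f"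
  have hom: "comm_ring_hom (\<lambda>g. poly g x)" for x :: 'k by unfold_locales auto
  define H where "H m = monom_eval B m" for m
  have H: "monom_eval (map_mat (\<lambda>g. poly g x) B) m = poly (H m) x" if "m \<in> ?K" for x m
    unfolding H_def by (rule monom_eval_map[OF hom B f that])
  \<comment> \<open>\<open>D * q\<close> bounds all degrees, so negative powers of s can be cleared,
    and being a multiple of q it does not shift residues. The \<open>Suc\<close> makes it at least
    q, hence larger than c.\<close>
  define D where "D = Suc (\<Sum>m\<in>?K. mdeg m)"
  have D: "mdeg m \<le> D * q" if "m \<in> ?K" for m
  proof -
    have "mdeg m \<le> D" unfolding D_def by (rule le_SucI, rule member_le_sum) (use that in auto)
    also have "D \<le> D * q" using q by simp
    finally show ?thesis .
  qed
  define N where "N = D * q + q * (\<Sum>m\<in>?K. degree (H m))"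
  \<comment> \<open>The contribution of the monomial m times s^(D q), as a polynomial in s; N bounds
    all exponents that occur.\<close>
  define G where "G m = (\<Sum>j\<le>degree (H m). monom (?l m * coeff (H m) j) (D * q - mdeg m + q * j))" for m
  have polyG: "poly (G m) s = s ^ (D * q) * (inverse s ^ mdeg m * ?l m * poly (H m) (s ^ q))"
    if "m \<in> ?K" "s \<noteq> 0" for m s
  proof -
    have "poly (G m) s = s ^ (D * q - mdeg m) * (?l m * poly (H m) (s ^ q))"
      by (simp add: G_def poly_sum poly_monom poly_altdef[of "H m"] sum_distrib_left power_add mult_ac flip: power_mult)
    also have "s ^ (D * q - mdeg m) = s ^ (D * q) * inverse s ^ mdeg m"
      using that D by (simp add: power_diff field_simps power_inverse)
    finally show ?thesis by (simp add: mult_ac)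
  qed
  have "poly (\<Sum>m\<in>?K. G m) s = 0" if "s \<noteq> 0" for s
  proof -
    have "map_mat (\<lambda>g. poly g (s ^ q)) B \<in> carrier_mat n n" using B by simp
    from eval_smult[OF this f, of "inverse s"] vanish[OF that]
    have "(\<Sum>m\<in>?K. inverse s ^ mdeg m * ?l m * poly (H m) (s ^ q)) = 0"
      by (simp add: H cong: sum.cong)
    thus ?thesis using that by (simp add: poly_sum polyG sum_distrib_left[symmetric] cong: sum.cong)
  qed
  \<comment> \<open>A polynomial in s with infinitely many zeros vanishes, so its coefficients may
    be sorted by exponent.\<close>
  hence "UNIV - {0} \<subseteq> {s. poly (\<Sum>m\<in>?K. G m) s = 0}" by auto
  hence "infinite {s. poly (\<Sum>m\<in>?K. G m) s = 0}"
    using infinite_UNIV_alg_closed[where 'a = 'k] finite_subset by (metis finite_Diff2 finite.emptyI finite.insertI)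
  hence G0: "(\<Sum>m\<in>?K. G m) = 0" using poly_roots_finite by blast
  \<comment> \<open>All exponents in \<open>G m\<close> are congruent to - mdeg m modulo q, so
    residue e collects exactly the monomials of weight c. Adding up their coefficients amounts to
    setting s = 1.\<close>
  define e where "e = (D * q - c) mod q"
  have "0 = (\<Sum>i\<le>N. if i mod q = e then coeff (\<Sum>m\<in>?K. G m) i else 0)" unfolding G0 by simp
  also have "\<dots> = (\<Sum>m\<in>?K. \<Sum>i\<le>N. if i mod q = e then coeff (G m) i else 0)"
    unfolding coeff_sum by (subst sum.swap) (intro sum.cong refl, auto)
  also have "\<dots> = (\<Sum>m\<in>?K. if mdeg m mod q = c then ?l m * poly (H m) 1 else 0)"
  proof (intro sum.cong refl)
    fix m assume m: "m \<in> ?K"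
    let ?e = "D * q - mdeg m"
    have le: "?e + q * j \<le> N" if "j \<le> degree (H m)" for j
    proof -
      have "degree (H m) \<le> (\<Sum>m\<in>?K. degree (H m))" by (rule member_le_sum) (use m in auto)
      hence "q * j \<le> q * (\<Sum>m\<in>?K. degree (H m))" using that by simp
      thus ?thesis unfolding N_def by (rule add_mono[OF diff_le_self])
    qed
    have "?e mod q = e \<longleftrightarrow> mdeg m mod q = c"
    proof -
      have "c \<le> D * q" using c D_def by simp
      thus ?thesis unfolding e_def using diff_mod_eq_iff[OF D[OF m], of c q] c by simp
    qed
    hence mod: "(?e + q * j) mod q = e \<longleftrightarrow> mdeg m mod q = c" for j by simp
    have "(\<Sum>i\<le>N. if i mod q = e then coeff (G m) i else 0) =
       (\<Sum>i\<le>N. \<Sum>j\<le>degree (H m). if i = ?e + q * j then (if i mod q = e then ?l m * coeff (H m) j else 0) else 0)"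
    proof (rule sum.cong[OF refl])
      fix i
      show "(if i mod q = e then coeff (G m) i else 0) = (\<Sum>j\<le>degree (H m).
          if i = ?e + q * j then (if i mod q = e then ?l m * coeff (H m) j else 0) else 0)"
      proof (cases "i mod q = e")
        case True
        thus ?thesis unfolding G_def coeff_sum coeff_monom by (auto intro!: sum.cong)
      next
        case False
        show ?thesis unfolding if_not_P[OF False] by simp
      qed
    qed
    also have "\<dots> = (\<Sum>j\<le>degree (H m). \<Sum>i\<le>N.
        if i = ?e + q * j then (if i mod q = e then ?l m * coeff (H m) j else 0) else 0)"
      by (rule sum.swap)
    also have "\<dots> = (\<Sum>j\<le>degree (H m). if mdeg m mod q = c then ?l m * coeff (H m) j else 0)"
      by (intro sum.cong refl) (use le mod in simp)
    also have "\<dots> = (if mdeg m mod q = c then ?l m * poly (H m) 1 else 0)"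
      by (simp add: poly_altdef sum_distrib_left)
    finally show "(\<Sum>i\<le>N. if i mod q = e then coeff (G m) i else 0) =
      (if mdeg m mod q = c then ?l m * poly (H m) 1 else 0)" .
  qed
  also have "\<dots> = eval_poly_at id (map_mat (\<lambda>g. poly g 1) B) (residue_part q c f)"
    unfolding eval_residue_part by (intro sum.cong refl) (simp add: H)
  finally show ?thesis by simp
qed

lemma residue_part_ge: "c \<ge> q \<Longrightarrow> q > 0 \<Longrightarrow> residue_part q c f = 0"
  using mod_less_divisor[of q] by (intro poly_mapping_eqI) (metis lookup_residue_part lookup_zero not_le)

text \<open>Any A in the class is conjugate to the member s = 1 of the cyclic family. Conjugating
  the whole family by the same constant matrix gives a family inside the class that passes through A
  and still has the shape B'(s^q) / s.\<close>

lemma vanishing_ideal_conj_class_graded: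
  fixes u :: "'k::alg_closed_field mat"
  assumes u: "u \<in> carrier_mat n n" and n: "n \<ge> 1"
    and J: "similar_mat u (jordan_type ms 1)"
    and char: "prime CHAR('k)" "q = CHAR('k) ^ r" and ms: "\<forall>m \<in> set ms. q dvd m"
    and f: "f \<in> vanishing_ideal n (conj_class n u)"
  shows "residue_part q c f \<in> vanishing_ideal n (conj_class n u)"
proof -
  have q: "q > 0" using char prime_gt_0_nat by simp
  have fc: "f \<in> entry_polys n" and f0: "\<And>A. similar_mat A u \<Longrightarrow> eval_poly_at id A f = 0"
    using f conj_class_iff[OF u n] by (auto simp: vanishing_ideal_def)
  have "sum_list ms = n"
    using similar_matE[OF J jordan_type_carrier] u by (metis carrier_matD(1))
  then obtain B where B: "B \<in> carrier_mat n n"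
    and sim: "\<And>s. s \<noteq> 0 \<Longrightarrow> similar_mat (inverse s \<cdot>\<^sub>m map_mat (\<lambda>g. poly g (s ^ q)) B) (jordan_type ms (1::'k))"
    using jordan_type_cyclic_family[OF char ms] by blast
  have "eval_poly_at id A (residue_part q c f) = 0" if A: "similar_mat A u" for A
  proof (cases "c < q")
    case True
    have one: "inverse (1::'k) \<cdot>\<^sub>m map_mat (\<lambda>g. poly g (1 ^ q)) B = map_mat (\<lambda>g. poly g 1) B"
      by (rule eq_matI) auto
    have "similar_mat A (map_mat (\<lambda>g. poly g 1) B)"
      using similar_mat_trans[OF similar_mat_trans[OF A J] similar_mat_sym[OF sim[of 1, unfolded one]]] by simp
    moreover have "map_mat (\<lambda>g. poly g 1) B \<in> carrier_mat n n" using B by simp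
    ultimately obtain g h where
      c: "A \<in> carrier_mat n n" "g \<in> carrier_mat n n" "h \<in> carrier_mat n n"
      and gh: "g * h = 1\<^sub>m n" "h * g = 1\<^sub>m n" and A_eq: "A = g * map_mat (\<lambda>g. poly g 1) B * h"
      by (elim similar_matE)
    let ?c = "map_mat (\<lambda>c. [:c:])"
    define B' where "B' = ?c g * B * ?c h"
    have B': "B' \<in> carrier_mat n n" using B c by (simp add: B'_def)
    have mapB': "map_mat (\<lambda>g. poly g x) B' = g * map_mat (\<lambda>g. poly g x) B * h" for x
    proof -
      have hom: "semiring_hom (\<lambda>g. poly g x)" by unfold_locales auto
      have "map_mat (\<lambda>g. poly g x) (?c M) = M" for M by (rule eq_matI) auto
      thus ?thesis unfolding B'_def using B c
        by (simp add: semiring_hom.mat_hom_mult[OF hom, of _ n n _ n])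
    qed
    have "eval_poly_at id (inverse s \<cdot>\<^sub>m map_mat (\<lambda>g. poly g (s ^ q)) B') f = 0" if s: "s \<noteq> 0" for s
    proof (rule f0)
      let ?M = "map_mat (\<lambda>g. poly g (s ^ q)) B"
      have M: "?M \<in> carrier_mat n n" using B by simp
      have "inverse s \<cdot>\<^sub>m map_mat (\<lambda>g. poly g (s ^ q)) B' = g * (inverse s \<cdot>\<^sub>m ?M) * h"
        unfolding mapB' using c M
        by (simp add: mult_smult_distrib[of _ n n _ n] mult_smult_assoc_mat[of _ n n _ n])
      hence "similar_mat (inverse s \<cdot>\<^sub>m map_mat (\<lambda>g. poly g (s ^ q)) B') (inverse s \<cdot>\<^sub>m ?M)"
        by (intro similar_matI[of _ _ g h n]) (use c gh B B' in auto)
      thus "similar_mat (inverse s \<cdot>\<^sub>m map_mat (\<lambda>g. poly g (s ^ q)) B') u"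
        using sim[OF s] J similar_mat_trans similar_mat_sym by blast
    qed
    from residue_part_vanishes[OF B' fc q True this] show ?thesis
      using A_eq mapB'[of 1] by simp
  next
    case False
    interpret comm_ring_hom "eval_poly_at id A" by (rule comm_ring_hom_eval_poly_at[OF comm_ring_hom_id])
    show ?thesis using False q by (simp add: residue_part_ge)
  qed
  thus ?thesis using entry_polys_residue_part[OF fc] conj_class_iff[OF u n] by (auto simp: vanishing_ideal_def)
qed

section \<open>Rank conditions\<close>

definition minor_poly :: "nat \<Rightarrow> 'a::comm_ring_1 mat \<Rightarrow> 'a mat \<Rightarrow> nat \<Rightarrow> 'a entry_poly" where
  "minor_poly n P Q j =
     det (map_mat const_poly P * (generic_mat n - 1\<^sub>m n) ^\<^sub>m j * map_mat const_poly Q)"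

lemma entry_polys_mat_mult:
  assumes "A \<in> carrier_mat a b" "B \<in> carrier_mat b c" "i < a" "j < c"
    and "\<And>l. l < b \<Longrightarrow> A $$ (i, l) \<in> entry_polys n" "\<And>l. l < b \<Longrightarrow> B $$ (l, j) \<in> entry_polys n"
  shows "(A * B) $$ (i, j) \<in> entry_polys n"
  using assms by (auto simp: scalar_prod_def intro!: entry_polys_sum)

lemma entry_polys_generic_power:
  assumes "i < n" "j < n"
  shows "((generic_mat n - 1\<^sub>m n) ^\<^sub>m k) $$ (i, j) \<in> entry_polys n"
  using assms
proof (induction k arbitrary: i j)
  case (Suc k)
  have G: "generic_mat n - 1\<^sub>m n \<in> carrier_mat n n" by (intro minus_carrier_mat) simp
  have entry: "(generic_mat n - 1\<^sub>m n) $$ (l, j) \<in> entry_polys n" if "l < n" for l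
    using that Suc.prems generic_mat_entry[of l n j] generic_mat_carrier[of n]
    by (cases "l = j") simp_all
  show ?case unfolding pow_mat.simps
    by (rule entry_polys_mat_mult[OF pow_carrier_mat[OF G] G Suc.prems Suc.IH[OF Suc.prems(1)] entry])
qed (simp add: generic_mat_def)

lemma minor_poly_mem:
  assumes "P \<in> carrier_mat s n" "Q \<in> carrier_mat n s"
  shows "minor_poly n P Q j \<in> entry_polys n"
proof -
  let ?G = "(generic_mat n - 1\<^sub>m n) ^\<^sub>m j :: 'a entry_poly mat"
  have G: "?G \<in> carrier_mat n n" by (intro pow_carrier_mat minus_carrier_mat) simp
  have PG: "(map_mat const_poly P * ?G) $$ (i, l) \<in> entry_polys n" if "i < s" "l < n" for i l
    by (rule entry_polys_mat_mult[of _ s n _ n]) (use G assms that entry_polys_generic_power in auto)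
  show ?thesis unfolding minor_poly_def
  proof (rule entry_polys_det[of _ s])
    fix i l assume il: "i < s" "l < s"
    show "(map_mat const_poly P * ?G * map_mat const_poly Q) $$ (i, l) \<in> entry_polys n"
      by (rule entry_polys_mat_mult[of _ s n _ s])
         (use il G assms PG in \<open>auto simp del: index_mult_mat(1)\<close>)
  qed (use assms G in auto)
qed

lemma map_eval_generic_power:
  assumes hom: "comm_ring_hom \<phi>" and A: "A \<in> carrier_mat n n"
  shows "map_mat (eval_poly_at \<phi> A) ((generic_mat n - 1\<^sub>m n) ^\<^sub>m j) = (A - 1\<^sub>m n) ^\<^sub>m j"
proof -
  interpret ev: comm_ring_hom "eval_poly_at \<phi> A" by (rule comm_ring_hom_eval_poly_at[OF hom])
  let ?G = "generic_mat n"
  have "map_mat (eval_poly_at \<phi> A) (?G - 1\<^sub>m n) = A - 1\<^sub>m n"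
  proof (rule eq_matI)
    fix i j assume "i < dim_row (A - 1\<^sub>m n)" "j < dim_col (A - 1\<^sub>m n)"
    hence ij: "i < n" "j < n" by auto
    have "eval_poly_at \<phi> A (?G $$ (i, j)) = map_mat (eval_poly_at \<phi> A) ?G $$ (i, j)"
      using ij generic_mat_carrier[of n] by (simp add: generic_mat_def)
    thus "map_mat (eval_poly_at \<phi> A) (?G - 1\<^sub>m n) $$ (i, j) = (A - 1\<^sub>m n) $$ (i, j)"
      unfolding map_eval_generic_mat[OF hom A] using ij by (simp add: ev.hom_minus)
  qed auto
  thus ?thesis by (subst ev.mat_hom_pow[of _ n]) (auto intro: minus_carrier_mat)
qed

lemma eval_minor_poly:
  assumes hom: "comm_ring_hom \<phi>" and A: "A \<in> carrier_mat n n"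
    and P: "P \<in> carrier_mat s n" and Q: "Q \<in> carrier_mat n s"
  shows "eval_poly_at \<phi> A (minor_poly n P Q j) = det (map_mat \<phi> P * (A - 1\<^sub>m n) ^\<^sub>m j * map_mat \<phi> Q)"
proof -
  interpret ev: comm_ring_hom "eval_poly_at \<phi> A" by (rule comm_ring_hom_eval_poly_at[OF hom])
  let ?G = "(generic_mat n - 1\<^sub>m n) ^\<^sub>m j"
  have G: "?G \<in> carrier_mat n n" by (intro pow_carrier_mat minus_carrier_mat) simp
  have PG: "map_mat const_poly P * ?G \<in> carrier_mat s n"
    by (rule mult_carrier_mat[OF _ G]) (use P in simp)
  show ?thesis unfolding minor_poly_def ev.hom_det[symmetric]
    using P Q by (subst ev.mat_hom_mult[OF PG], simp, subst ev.mat_hom_mult[OF _ G, of _ s], simp)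
      (simp add: map_eval_const_mat[OF hom] map_eval_generic_power[OF hom A])
qed

lemma map_mat_id: "map_mat id X = X"
  by (rule eq_matI) auto

lemmas eval_minor_poly_id = eval_minor_poly[OF comm_ring_hom_id, unfolded map_mat_id]

section \<open>Powers of X - 1 at scalar multiples of unipotent matrices\<close>

lemma map_jordan_type:
  assumes "comm_ring_hom \<phi>"
  shows "map_mat \<phi> (jordan_type ms a) = jordan_type ms (\<phi> a)"
proof (induction ms)
  case Nil
  show ?case by (rule eq_matI) (auto simp: jordan_matrix_def)
next
  case (Cons m ms)
  interpret comm_ring_hom \<phi> by fact
  have "map_mat \<phi> (jordan_block m a) = jordan_block m (\<phi> a)" by (rule eq_matI) auto
  moreover have "map_mat \<phi> (0\<^sub>m x y) = 0\<^sub>m x y" for x y by (rule eq_matI) auto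
  ultimately show ?case unfolding jordan_type_Cons
    by (subst map_four_block_mat[OF jordan_block_carrier zero_carrier_mat zero_carrier_mat jordan_type_carrier])
       (simp add: Cons)
qed

text \<open>The assumption encodes \<eta> = 1 - 1/\<zeta> without division. Each block has \<zeta> -
  1 = \<zeta> \<eta> on the diagonal and \<zeta> above it.\<close>

lemma jordan_type_shift:
  fixes \<zeta> \<eta> :: "'a::comm_ring_1"
  assumes "\<zeta> * \<eta> = \<zeta> - 1"
  shows "\<zeta> \<cdot>\<^sub>m jordan_type ms 1 - 1\<^sub>m (sum_list ms) = \<zeta> \<cdot>\<^sub>m jordan_type ms \<eta>"
proof (induction ms)
  case Nil
  show ?case by (rule eq_matI) (auto simp: jordan_matrix_def)
next
  case (Cons m ms)
  have block: "\<zeta> \<cdot>\<^sub>m jordan_block m 1 - 1\<^sub>m m = \<zeta> \<cdot>\<^sub>m jordan_block m \<eta>"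
    by (rule eq_matI) (use assms in auto)
  have "\<zeta> \<cdot>\<^sub>m four_block_mat A (0\<^sub>m a b) (0\<^sub>m b a) B - 1\<^sub>m (a + b) =
      four_block_mat (\<zeta> \<cdot>\<^sub>m A - 1\<^sub>m a) (0\<^sub>m a b) (0\<^sub>m b a) (\<zeta> \<cdot>\<^sub>m B - 1\<^sub>m b)"
    if "A \<in> carrier_mat a a" "B \<in> carrier_mat b b" for A B :: "'a mat" and a b
    by (rule eq_matI) (use that in auto)
  from this[OF jordan_block_carrier[of m 1] jordan_type_carrier[of 1 ms]]
  have "\<zeta> \<cdot>\<^sub>m jordan_type (m # ms) 1 - 1\<^sub>m (sum_list (m # ms)) = four_block_mat (\<zeta> \<cdot>\<^sub>m jordan_block m \<eta>)
      (0\<^sub>m m (sum_list ms)) (0\<^sub>m (sum_list ms) m) (\<zeta> \<cdot>\<^sub>m jordan_type ms \<eta>)"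
    unfolding jordan_type_Cons by (simp add: block Cons)
  also have "\<dots> = \<zeta> \<cdot>\<^sub>m jordan_type (m # ms) \<eta>"
    unfolding jordan_type_Cons
    by (subst smult_four_block_mat[OF jordan_block_carrier zero_carrier_mat zero_carrier_mat jordan_type_carrier])
       (auto intro!: cong_four_block_mat eq_matI)
  finally show ?case .
qed

lemma smult_pow_mat:
  fixes A :: "'a::comm_ring_1 mat"
  assumes "A \<in> carrier_mat n n"
  shows "(c \<cdot>\<^sub>m A) ^\<^sub>m k = c ^ k \<cdot>\<^sub>m A ^\<^sub>m k"
proof (induction k)
  case 0
  show ?case by (rule eq_matI) (use assms in auto)
next
  case (Suc k)
  have Ak: "A ^\<^sub>m k \<in> carrier_mat n n" by (rule pow_carrier_mat[OF assms])
  have "(c \<cdot>\<^sub>m A) ^\<^sub>m Suc k = (c ^ k \<cdot>\<^sub>m A ^\<^sub>m k) * (c \<cdot>\<^sub>m A)" by (simp add: Suc)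
  also have "\<dots> = c ^ k \<cdot>\<^sub>m (c \<cdot>\<^sub>m (A ^\<^sub>m k * A))"
    using Ak assms by (simp only: mult_smult_assoc_mat[of _ n n _ n] mult_smult_distrib[of _ n n _ n] smult_carrier_mat)
      (rule eq_matI, auto simp: mult_ac)
  also have "\<dots> = c ^ Suc k \<cdot>\<^sub>m A ^\<^sub>m Suc k" by (rule eq_matI) (auto simp: mult_ac)
  finally show ?case .
qed

lemma scaled_unipotent_power:
  fixes \<zeta> \<eta> :: "'a::comm_ring_1"
  assumes \<eta>: "\<zeta> * \<eta> = \<zeta> - 1" and n: "sum_list ms = n"
    and g: "g \<in> carrier_mat n n" and h: "h \<in> carrier_mat n n" and gh: "g * h = 1\<^sub>m n" "h * g = 1\<^sub>m n"
  shows "(\<zeta> \<cdot>\<^sub>m (g * jordan_type ms 1 * h) - 1\<^sub>m n) ^\<^sub>m j = \<zeta> ^ j \<cdot>\<^sub>m (g * jordan_type ms \<eta> ^\<^sub>m j * h)"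
proof -
  have J: "jordan_type ms a \<in> carrier_mat n n" for a :: 'a using jordan_type_carrier[of a ms] n by simp
  let ?M = "\<zeta> \<cdot>\<^sub>m jordan_type ms 1"
  have M: "?M \<in> carrier_mat n n" using J by simp
  have "g * (?M - 1\<^sub>m n) * h = (g * ?M - g) * h"
    using g M by (simp add: mult_minus_distrib_mat[of _ n n _ n])
  also have "\<dots> = g * ?M * h - g * h" using g h M by (intro minus_mult_distrib_mat[of _ n n]) auto
  also have "g * ?M * h = \<zeta> \<cdot>\<^sub>m (g * jordan_type ms 1 * h)"
    using g h J[of 1] by (simp add: mult_smult_assoc_mat[of _ n n _ n] mult_smult_distrib[of _ n n _ n])
  finally have eq: "\<zeta> \<cdot>\<^sub>m (g * jordan_type ms 1 * h) - 1\<^sub>m n = g * (\<zeta> \<cdot>\<^sub>m jordan_type ms \<eta>) * h"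
    using gh jordan_type_shift[OF \<eta>, of ms] n by simp
  have c: "g * (\<zeta> \<cdot>\<^sub>m jordan_type ms \<eta>) * h \<in> carrier_mat n n"
    by (rule mult_carrier_mat[OF mult_carrier_mat[OF g smult_carrier_mat[OF J]] h])
  have "similar_mat_wit (g * (\<zeta> \<cdot>\<^sub>m jordan_type ms \<eta>) * h) (\<zeta> \<cdot>\<^sub>m jordan_type ms \<eta>) g h"
    by (rule similar_mat_witI[OF gh refl c _ g h]) (use J in simp)
  from similar_mat_wit_pow_id[OF this, of j]
  have "(g * (\<zeta> \<cdot>\<^sub>m jordan_type ms \<eta>) * h) ^\<^sub>m j = g * (\<zeta> ^ j \<cdot>\<^sub>m jordan_type ms \<eta> ^\<^sub>m j) * h"
    by (simp add: smult_pow_mat[OF J])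
  also have "\<dots> = \<zeta> ^ j \<cdot>\<^sub>m (g * jordan_type ms \<eta> ^\<^sub>m j * h)"
    using g h pow_carrier_mat[OF J[of \<eta>], of j]
    by (simp add: mult_smult_assoc_mat[of _ n n _ n] mult_smult_distrib[of _ n n _ n])
  finally show ?thesis unfolding eq .
qed

lemma unipotent_power:
  fixes g :: "'a::comm_ring_1 mat"
  assumes n: "sum_list ms = n"
    and g: "g \<in> carrier_mat n n" and h: "h \<in> carrier_mat n n" and gh: "g * h = 1\<^sub>m n" "h * g = 1\<^sub>m n"
  shows "(g * jordan_type ms 1 * h - 1\<^sub>m n) ^\<^sub>m j = g * jordan_type ms 0 ^\<^sub>m j * h"
proof -
  have "1 \<cdot>\<^sub>m M = M" for M :: "'a mat" by (rule eq_matI) auto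
  thus ?thesis using scaled_unipotent_power[OF _ assms, of 1 0 j] by simp
qed

lemma conjugate_minor:
  fixes M :: "'a::comm_ring_1 mat"
  assumes M: "M \<in> carrier_mat n n" and g: "g \<in> carrier_mat n n" and h: "h \<in> carrier_mat n n"
    and hg: "h * g = 1\<^sub>m n" and P: "P \<in> carrier_mat s n" and Q: "Q \<in> carrier_mat n s"
  shows "(P * h) * (g * M * h) * (g * Q) = P * M * Q"
proof -
  have "(P * h) * (g * M * h) * (g * Q) = P * (h * g) * M * (h * g) * Q"
    using assms(1-3) P Q
    by (simp add: assoc_mult_mat[of _ s n _ n _ n] assoc_mult_mat[of _ n n _ n _ n]
        assoc_mult_mat[of _ s n _ n _ s] assoc_mult_mat[of _ n n _ n _ s])
  thus ?thesis using M P by (simp add: hg)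
qed

section \<open>Rank conditions that cut out the class in its closure\<close>

lemma similar_jordan_type_sum_list:
  fixes A :: "'a::comm_ring_1 mat"
  assumes "similar_mat A (jordan_type ms a)" "A \<in> carrier_mat n n"
  shows "sum_list ms = n"
  using similar_matE[OF assms(1) jordan_type_carrier] assms(2) by (metis carrier_matD(1))

text \<open>With \<open>unipotent_minor_eq_0\<close> this says that (A - 1)^j has rank exactly the
  sum of the m - j, in a form that polynomials in the entries can test.\<close>

lemma unipotent_minor_eq_1:
  fixes A :: "'a::field mat"
  assumes A: "A \<in> carrier_mat n n" and sim: "similar_mat A (jordan_type ms 1)"
  shows "\<exists>P \<in> carrier_mat (\<Sum>m\<leftarrow>ms. m - j) n. \<exists>Q \<in> carrier_mat n (\<Sum>m\<leftarrow>ms. m - j).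
    det (P * (A - 1\<^sub>m n) ^\<^sub>m j * Q) = 1"
proof -
  note n = similar_jordan_type_sum_list[OF sim A]
  obtain g h where g: "g \<in> carrier_mat n n" and h: "h \<in> carrier_mat n n"
    and gh: "g * h = 1\<^sub>m n" "h * g = 1\<^sub>m n" and Aeq: "A = g * jordan_type ms 1 * h"
    using similar_matE[OF sim jordan_type_carrier] unfolding n by metis
  let ?M = "jordan_type ms (0::'a) ^\<^sub>m j" and ?s = "\<Sum>m\<leftarrow>ms. m - j"
  have M: "?M \<in> carrier_mat n n" using pow_carrier_mat[OF jordan_type_carrier[of "0::'a" ms], of j] n by simp
  obtain P Q where P: "P \<in> carrier_mat ?s n" and Q: "Q \<in> carrier_mat n ?s" and det: "det (P * ?M * Q) = 1"
    using has_minor_jordan_type[OF comm_ring_hom_id, where ms = ms and \<eta> = "0::'a" and k = j]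
    unfolding has_minor_def carrier_matD[OF M] map_mat_id by auto
  have "det ((P * h) * (A - 1\<^sub>m n) ^\<^sub>m j * (g * Q)) = 1"
    unfolding Aeq unipotent_power[OF n g h gh] conjugate_minor[OF M g h gh(2) P Q] det ..
  thus ?thesis using P Q g h by (intro bexI[of _ "P * h"] bexI[of _ "g * Q"]) auto
qed

lemma unipotent_minor_eq_0:
  fixes A :: "'a::field mat"
  assumes A: "A \<in> carrier_mat n n" and sim: "similar_mat A (jordan_type ms 1)"
    and P: "P \<in> carrier_mat s n" and Q: "Q \<in> carrier_mat n s" and s: "(\<Sum>m\<leftarrow>ms. m - j) < s"
  shows "det (P * (A - 1\<^sub>m n) ^\<^sub>m j * Q) = 0"
proof -
  note n = similar_jordan_type_sum_list[OF sim A]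
  obtain g h where g: "g \<in> carrier_mat n n" and h: "h \<in> carrier_mat n n"
    and gh: "g * h = 1\<^sub>m n" "h * g = 1\<^sub>m n" and Aeq: "A = g * jordan_type ms 1 * h"
    using similar_matE[OF sim jordan_type_carrier] unfolding n by metis
  let ?M = "jordan_type ms (0::'a) ^\<^sub>m j" and ?t = "\<Sum>m\<leftarrow>ms. m - j"
  have M: "?M \<in> carrier_mat n n" using pow_carrier_mat[OF jordan_type_carrier[of "0::'a" ms], of j] n by simp
  obtain B C where B: "B \<in> carrier_mat n ?t" and C: "C \<in> carrier_mat ?t n" and BC: "?M = B * C"
    using factors_through_jordan_type_0[where k = j and ms = ms and 'a = 'a]
    unfolding factors_through_def carrier_matD[OF M] by blast
  have "P * (A - 1\<^sub>m n) ^\<^sub>m j * Q = (P * g * B) * (C * h * Q)"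
    unfolding Aeq unipotent_power[OF n g h gh] BC using P Q B C g h
    by (simp add: assoc_mult_mat[of _ s n _ n _ n] assoc_mult_mat[of _ n n _ n _ n]
        assoc_mult_mat[of _ s n _ n _ s] assoc_mult_mat[of _ n n _ n _ s]
        assoc_mult_mat[of _ n n _ ?t _ n] assoc_mult_mat[of _ n ?t _ n _ n]
        assoc_mult_mat[of _ n ?t _ n _ s] assoc_mult_mat[of _ ?t n _ n _ s] assoc_mult_mat[of _ s n _ ?t _ s]
        assoc_mult_mat[of _ s n _ n _ ?t] assoc_mult_mat[of _ n n _ ?t _ s])
  thus ?thesis using det_mult_eq_0_if_factors[of "P * g * B" s ?t "C * h * Q"] P Q B C g h s by simp
qed

lemma minor_poly_vanishes:
  fixes u :: "'k::alg_closed_field mat"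
  assumes u: "u \<in> carrier_mat n n" and n: "n \<ge> 1" and J: "similar_mat u (jordan_type ms 1)"
    and P: "P \<in> carrier_mat s n" and Q: "Q \<in> carrier_mat n s" and s: "(\<Sum>m\<leftarrow>ms. m - j) < s"
  shows "minor_poly n P Q j \<in> vanishing_ideal n (conj_class n u)"
proof -
  have "eval_poly_at id A (minor_poly n P Q j) = 0" if A: "similar_mat A u" for A
  proof -
    have Ac: "A \<in> carrier_mat n n" using similar_matE[OF A u] by metis
    show ?thesis
      unfolding eval_minor_poly_id[OF Ac P Q]
      by (rule unipotent_minor_eq_0[OF Ac similar_mat_trans[OF A J] P Q s])
  qed
  thus ?thesis using minor_poly_mem[OF P Q] conj_class_iff[OF u n] by (auto simp: vanishing_ideal_def)
qed

lemma sum_list_diff_eq_0: "sum_list ms \<le> j \<Longrightarrow> (\<Sum>m\<leftarrow>ms. m - j) = (0::nat)"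
  by (induction ms) auto

text \<open>
  The closure of the class consists of unipotent matrices \<open>A\<close> with \<open>rank (A - 1)\<^sup>j \<le> rank (u - 1)\<^sup>j\<close> for
  all \<open>j\<close>, and equality for all \<open>j\<close> forces \<open>A\<close> to be conjugate to \<open>u\<close>.  A product of minors, one for each
  \<open>j\<close>, therefore separates \<open>u\<close> from the boundary of its class.
\<close>

lemma boundary_separated:
  fixes u :: "'k::alg_closed_field mat"
  assumes u: "u \<in> carrier_mat n n" and n: "n \<ge> 1" and unip: "unipotent_mat n u"
    and J: "similar_mat u (jordan_type ms 1)" and ms0: "0 \<notin> set ms"
  shows "\<exists>F \<in> vanishing_ideal n (zariski_closure n (conj_class n u) - conj_class n u). eval_poly_at id u F \<noteq> 0"
proof -
  let ?C = "conj_class n u" and ?S = "\<lambda>j ms. \<Sum>m\<leftarrow>ms. m - j :: nat"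
  note sum_ms = similar_jordan_type_sum_list[OF J u]
  have "\<forall>j. \<exists>P Q. P \<in> carrier_mat (?S j ms) n \<and> Q \<in> carrier_mat n (?S j ms) \<and>
      det (P * (u - 1\<^sub>m n) ^\<^sub>m j * Q) = 1"
    using unipotent_minor_eq_1[OF u J] by blast
  then obtain P Q where PQ: "\<And>j. P j \<in> carrier_mat (?S j ms) n" "\<And>j. Q j \<in> carrier_mat n (?S j ms)"
    "\<And>j. det (P j * (u - 1\<^sub>m n) ^\<^sub>m j * Q j) = 1" by metis
  \<comment> \<open>The range j \<le> n suffices: for larger j the truncated sums of
    \<open>ms\<close> are zero, and no smaller value is possible.\<close>
  define F where "F = (\<Prod>j\<le>n. minor_poly n (P j) (Q j) j)"
  have F: "F \<in> entry_polys n" unfolding F_def by (intro entry_polys_prod minor_poly_mem[OF PQ(1,2)])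
  have evalF: "eval_poly_at id A F = (\<Prod>j\<le>n. det (P j * (A - 1\<^sub>m n) ^\<^sub>m j * Q j))"
    if "A \<in> carrier_mat n n" for A
  proof -
    interpret ev: comm_ring_hom "eval_poly_at id A" by (rule comm_ring_hom_eval_poly_at[OF comm_ring_hom_id])
    show ?thesis unfolding F_def ev.hom_prod using eval_minor_poly_id[OF that PQ(1,2)] by simp
  qed
  have "eval_poly_at id A F = 0" if A: "A \<in> zariski_closure n ?C" "A \<notin> ?C" for A
  proof -
    have Ac: "A \<in> carrier_mat n n" and A0: "\<And>f. f \<in> vanishing_ideal n ?C \<Longrightarrow> eval_poly_at id A f = 0"
      using A by (auto simp: zariski_closure_def)
    obtain N where N: "(u - 1\<^sub>m n) ^\<^sub>m N = 0\<^sub>m n n" using unip by (auto simp: unipotent_mat_def)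
    let ?G = "(generic_mat n - 1\<^sub>m n) ^\<^sub>m N :: 'k entry_poly mat"
    have G: "?G \<in> carrier_mat n n" by (intro pow_carrier_mat minus_carrier_mat) simp
    have evG: "eval_poly_at id X (?G $$ (i, j)) = ((X - 1\<^sub>m n) ^\<^sub>m N) $$ (i, j)"
      if "X \<in> carrier_mat n n" "i < n" "j < n" for X i j
    proof -
      have "eval_poly_at id X (?G $$ (i, j)) = map_mat (eval_poly_at id X) ?G $$ (i, j)"
        using that G by (subst index_map_mat) auto
      thus ?thesis unfolding map_eval_generic_power[OF comm_ring_hom_id that(1)] .
    qed
    \<comment> \<open>Nilpotency of X - 1 with the exponent N of u is a closed condition satisfied
      on the class, so A is unipotent too and has a Jordan type \<open>ms'\<close> over the
      eigenvalue 1.\<close>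
    have "?G $$ (i, j) \<in> vanishing_ideal n ?C" if ij: "i < n" "j < n" for i j
    proof -
      have "eval_poly_at id X (?G $$ (i, j)) = 0" if X: "similar_mat X u" for X
      proof -
        obtain g h where Xc: "X \<in> carrier_mat n n" and g: "g \<in> carrier_mat n n" and h: "h \<in> carrier_mat n n"
          and gh: "g * h = 1\<^sub>m n" "h * g = 1\<^sub>m n" and Xeq: "X = g * u * h"
          using similar_matE[OF X u] by metis
        have "X - 1\<^sub>m n = g * (u - 1\<^sub>m n) * h"
          unfolding Xeq using g h u gh
          by (simp add: mult_minus_distrib_mat[of _ n n _ n] minus_mult_distrib_mat[of _ n n _ _ n])
        hence "similar_mat_wit (X - 1\<^sub>m n) (u - 1\<^sub>m n) g h"
          by (rule similar_mat_witI[OF gh]) (use g h u Xc in \<open>auto intro: minus_carrier_mat\<close>)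
        from similar_mat_wit_pow_id[OF this, of N] have "(X - 1\<^sub>m n) ^\<^sub>m N = 0\<^sub>m n n"
          unfolding N using g h by simp
        thus ?thesis using evG[OF Xc ij] ij by simp
      qed
      thus ?thesis using entry_polys_generic_power[OF ij] conj_class_iff[OF u n]
        by (auto simp: vanishing_ideal_def)
    qed
    hence "((A - 1\<^sub>m n) ^\<^sub>m N) $$ (i, j) = 0" if "i < n" "j < n" for i j
      using A0 evG[OF Ac that] that by simp
    moreover have "(A - 1\<^sub>m n) ^\<^sub>m N \<in> carrier_mat n n" by (intro pow_carrier_mat minus_carrier_mat) simp
    ultimately have "(A - 1\<^sub>m n) ^\<^sub>m N = 0\<^sub>m n n" by (intro eq_matI) auto
    hence "unipotent_mat n A" using Ac by (auto simp: unipotent_mat_def)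
    then obtain ms' where "jordan_nf A (map (\<lambda>m. (m, 1)) ms')" using unipotent_jordan_nf by blast
    hence J': "similar_mat A (jordan_type ms' 1)" and ms'0: "0 \<notin> set ms'"
      by (force simp: jordan_nf_def)+
    note sum_ms' = similar_jordan_type_sum_list[OF J' Ac]
    \<comment> \<open>Semicontinuity of rank: a minor equal to 1 at A and larger than the rank on
      the class would be an equation of the class that A violates.\<close>
    have le: "?S j ms' \<le> ?S j ms" for j
    proof (rule ccontr)
      assume gt: "\<not> ?S j ms' \<le> ?S j ms"
      obtain P' Q' where P': "P' \<in> carrier_mat (?S j ms') n" and Q': "Q' \<in> carrier_mat n (?S j ms')"
        and det: "det (P' * (A - 1\<^sub>m n) ^\<^sub>m j * Q') = 1"
        using unipotent_minor_eq_1[OF Ac J'] by blast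
      have "eval_poly_at id A (minor_poly n P' Q' j) = 0"
        by (rule A0[OF minor_poly_vanishes[OF u n J P' Q']]) (use gt in simp)
      thus False unfolding eval_minor_poly_id[OF Ac P' Q'] det by simp
    qed
    have "\<exists>j. ?S j ms' \<noteq> ?S j ms"
    proof (rule ccontr)
      assume "\<not> (\<exists>j. ?S j ms' \<noteq> ?S j ms)"
      hence "mset ms' = mset ms" using ms0 ms'0 by (intro mset_eq_if_truncated_sums_eq) auto
      hence "similar_mat (jordan_type ms' (1::'k)) (jordan_type ms 1)"
        by (intro similar_jordan_matrix_perm) simp
      hence "similar_mat A u" using J J' similar_mat_trans similar_mat_sym by blast
      thus False using A(2) conj_class_iff[OF u n] by blast
    qed
    then obtain j where j: "?S j ms' < ?S j ms" using le by (metis le_neq_implies_less)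
    have "j \<le> n" using j sum_list_diff_eq_0[of ms j] sum_ms by (cases "j \<le> n") auto
    moreover have "det (P j * (A - 1\<^sub>m n) ^\<^sub>m j * Q j) = 0"
      by (rule unipotent_minor_eq_0[OF Ac J' PQ(1,2) j])
    ultimately show ?thesis unfolding evalF[OF Ac] by (intro prod_zero) auto
  qed
  moreover have "eval_poly_at id u F \<noteq> 0" unfolding evalF[OF u] by (simp add: PQ(3))
  ultimately show ?thesis using F by (intro bexI[of _ F]) (auto simp: vanishing_ideal_def)
qed

section \<open>The stabilizer\<close>

text \<open>Equality of subschemes is local, so a nonzero value c is tested at a prime P containing
  all g with g(u) c = 0. This P is a point of the class because F(u) is a unit. There s f(\<zeta> X)
  lies in the ideal of the class for some s outside P; evaluation at u gives s(u) c = 0, so s is in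
  P.\<close>

lemma vanishes_on_stabilizing_translate:
  fixes u :: "'k::field mat" and \<phi> :: "'k \<Rightarrow> 'r::comm_ring_1"
  assumes hom: "comm_ring_hom \<phi>" and u: "u \<in> carrier_mat n n" "u \<in> C"
    and F: "F \<in> vanishing_ideal n (zariski_closure n C - C)" "eval_poly_at id u F \<noteq> 0"
    and stab: "translate_subscheme n (\<zeta> \<cdot>\<^sub>m 1\<^sub>m n) (reduced_subscheme_base_change n \<phi> C) =
      reduced_subscheme_base_change n \<phi> C"
    and f: "f \<in> vanishing_ideal n C"
  shows "eval_poly_at \<phi> (\<zeta> \<cdot>\<^sub>m map_mat \<phi> u) f = 0"
proof (rule ccontr)
  define c where "c = eval_poly_at \<phi> (\<zeta> \<cdot>\<^sub>m map_mat \<phi> u) f"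
  assume "eval_poly_at \<phi> (\<zeta> \<cdot>\<^sub>m map_mat \<phi> u) f \<noteq> 0"
  hence c0: "c \<noteq> 0" by (simp add: c_def)
  interpret \<phi>: comm_ring_hom \<phi> by fact
  let ?A = "mat_ring n :: 'r entry_poly ring" and ?U = "map_mat \<phi> u" and ?m = "Poly_Mapping.map \<phi>"
  have U: "?U \<in> carrier_mat n n" using u by simp
  interpret A: cring ?A by (rule cring_mat_ring)
  interpret ev: comm_ring_hom "eval_poly_at id ?U" by (rule comm_ring_hom_eval_poly_at[OF comm_ring_hom_id])
  define I where "I = extended_ideal n \<phi> (vanishing_ideal n C)"
  define J where "J = extended_ideal n \<phi> (vanishing_ideal n (zariski_closure n C - C))"
  have gen: "?m ` vanishing_ideal n X \<subseteq> entry_polys n" for X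
    using entry_polys_map[OF hom] by (auto simp: vanishing_ideal_def)
  have I_id: "ideal I ?A" and mI: "?m g \<in> I" if "g \<in> vanishing_ideal n C" for g
    using genideal_mat_ring[OF gen[of C]] that by (auto simp: I_def extended_ideal_def)
  have mJ: "?m F \<in> J" using genideal_mat_ring[OF gen] F by (auto simp: J_def extended_ideal_def)
  have ev_m: "eval_poly_at id ?U (?m g) = \<phi> (eval_poly_at id u g)" if "g \<in> entry_polys n" for g
    unfolding eval_poly_at_map[OF hom] by (rule eval_poly_at_hom[OF hom u(1) that])
  have fc: "?m f \<in> entry_polys n" using gen f by auto
  have c_eq: "c = eval_poly_at id ?U (scale_vars n \<zeta> (?m f))"
    unfolding c_def eval_scale_vars[OF U fc] eval_poly_at_map[OF hom] ..
  have I_sub: "I \<subseteq> {g \<in> entry_polys n. eval_poly_at id ?U g * 1 = 0}"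
    unfolding I_def extended_ideal_def
  proof (rule genideal_mat_ring_minimal[OF ideal_eval_eq_0[OF comm_ring_hom_id]], rule subsetI)
    fix g' assume "g' \<in> ?m ` vanishing_ideal n C"
    then obtain g where g: "g' = ?m g" "g \<in> entry_polys n" "eval_poly_at id u g = 0"
      "?m g \<in> entry_polys n"
      using gen[of C] u(2) by (auto simp: vanishing_ideal_def)
    thus "g' \<in> {g \<in> entry_polys n. eval_poly_at id ?U g * 1 = 0}" using ev_m[OF g(2)] by simp
  qed
  define L where "L = {g \<in> entry_polys n. eval_poly_at id ?U g * c = 0}"
  have "ideal L ?A" unfolding L_def by (rule ideal_eval_eq_0[OF comm_ring_hom_id])
  moreover have "\<one>\<^bsub>?A\<^esub> \<notin> L" using c0 by (simp add: L_def)
  ultimately obtain P where P: "primeideal P ?A" and LP: "L \<subseteq> P"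
    using A.exists_primeideal_above by blast
  note D = ideal_mat_ringD[OF primeideal.axioms(1)[OF P]]
  have one: "1 \<notin> Q" if Q: "primeideal Q ?A" for Q
  proof
    assume "1 \<in> Q"
    hence "\<one>\<^bsub>?A\<^esub> \<in> Q" by simp
    hence "Q = carrier ?A" by (rule ideal.one_imp_carrier[OF primeideal.axioms(1)[OF Q]])
    thus False using primeideal.I_notcarr[OF Q] by simp
  qed
  have "\<not> J \<subseteq> P"
  proof
    assume "J \<subseteq> P"
    hence mF: "?m F \<in> P" using mJ by auto
    have Fc: "F \<in> entry_polys n" using F by (simp add: vanishing_ideal_def)
    define d where "d = eval_poly_at id u F"
    \<comment> \<open>Modulo P the polynomial F is the constant F(u), the image of a nonzero element
      of k and hence invertible.\<close>
    have "?m F - const_poly (\<phi> d) \<in> L"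
      using entry_polys_map[OF hom Fc] ev_m[OF Fc]
      by (simp add: L_def ev.hom_minus eval_poly_at_const[OF comm_ring_hom_id] d_def)
    hence "?m F - const_poly (\<phi> d) \<in> P" using LP by auto
    from D(5)[OF mF this] have "const_poly (\<phi> d) \<in> P" by simp
    hence "const_poly (\<phi> (inverse d)) * const_poly (\<phi> d) \<in> P" by (rule D(4)) simp
    moreover have "const_poly (\<phi> (inverse d)) * const_poly (\<phi> d) = const_poly (\<phi> (inverse d * d))"
      by (simp add: const_poly_def mult_single \<phi>.hom_mult)
    moreover have "inverse d * d = 1" using F(2) by (simp add: d_def)
    ultimately have "1 \<in> P" by (simp add: const_poly_def)
    thus False using one[OF P] by simp
  qed
  moreover have "I \<subseteq> L" using I_sub unfolding L_def by force
  hence "I \<subseteq> P" using LP by simp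
  ultimately have "(P, local_ideal ?A I P) \<in> reduced_subscheme_base_change n \<phi> C"
    using P by (auto simp: reduced_subscheme_base_change_def lc_subscheme_def I_def J_def)
  hence "({g \<in> entry_polys n. scale_vars n \<zeta> g \<in> P},
      {g \<in> entry_polys n. scale_vars n \<zeta> g \<in> local_ideal ?A I P}) \<in>
      translate_subscheme n (\<zeta> \<cdot>\<^sub>m 1\<^sub>m n) (reduced_subscheme_base_change n \<phi> C)"
    unfolding translate_subscheme_scalar by force
  \<comment> \<open>P' is the translate of P. By stability its local ideal is the one of the class
    itself, which contains f with denominator 1.\<close>
  then obtain P' where P': "primeideal P' ?A"
    and loc: "{g \<in> entry_polys n. scale_vars n \<zeta> g \<in> local_ideal ?A I P} = local_ideal ?A I P'"
    unfolding stab by (auto simp: reduced_subscheme_base_change_def lc_subscheme_def I_def)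
  have "?m f \<in> local_ideal ?A I P'"
    unfolding local_ideal_def using one[OF P'] mI[OF f] fc by (auto intro!: bexI[of _ 1])
  hence "scale_vars n \<zeta> (?m f) \<in> local_ideal ?A I P" using loc by auto
  then obtain s where s: "s \<in> entry_polys n" "s \<notin> P" "s * scale_vars n \<zeta> (?m f) \<in> I"
    by (auto simp: local_ideal_def)
  have "eval_poly_at id ?U s * c = 0" using s(3) I_sub by (auto simp: c_eq ev.hom_mult)
  thus False using s LP by (auto simp: L_def)
qed

section \<open>Roots of unity from a minor at the scaled element\<close>

lemma has_minor_hom:
  assumes "has_minor \<psi> M s d" and hom: "comm_ring_hom \<theta>"
  shows "has_minor (\<lambda>x. \<theta> (\<psi> x)) (map_mat \<theta> M) s (\<theta> d)"
proof -
  interpret comm_ring_hom \<theta> by fact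
  from assms(1) obtain P Q where P: "P \<in> carrier_mat s (dim_row M)" and Q: "Q \<in> carrier_mat (dim_col M) s"
    and d: "det (map_mat \<psi> P * M * map_mat \<psi> Q) = d"
    unfolding has_minor_def by blast
  have comp: "map_mat \<theta> (map_mat \<psi> X) = map_mat (\<lambda>x. \<theta> (\<psi> x)) X" for X by (rule eq_matI) auto
  have c: "map_mat \<psi> P \<in> carrier_mat s (dim_row M)" "M \<in> carrier_mat (dim_row M) (dim_col M)"
    "map_mat \<psi> Q \<in> carrier_mat (dim_col M) s" using P Q by auto
  have "map_mat \<theta> (map_mat \<psi> P * M * map_mat \<psi> Q) =
      map_mat (\<lambda>x. \<theta> (\<psi> x)) P * map_mat \<theta> M * map_mat (\<lambda>x. \<theta> (\<psi> x)) Q"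
    by (subst mat_hom_mult[OF mult_carrier_mat[OF c(1,2)] c(3)], subst mat_hom_mult[OF c(1,2)])
       (simp add: comp)
  from arg_cong[OF this, of det, unfolded hom_det d]
  show ?thesis unfolding has_minor_def
    by (intro bexI[of _ P] bexI[of _ Q]) (use P Q in auto)
qed

lemma comm_ring_hom_eval_map_poly:
  assumes "comm_ring_hom \<phi>"
  shows "comm_ring_hom (\<lambda>f. poly (map_poly \<phi> f) \<eta>)"
proof -
  interpret \<phi>: comm_ring_hom \<phi> by fact
  interpret m: map_poly_comm_ring_hom \<phi> ..
  show ?thesis
    by unfold_locales (auto simp: m.hom_add m.hom_mult)
qed

text \<open>
  The minor is computed over \<open>k[t]\<close> and specialised at \<open>t = \<eta>\<close>, because the library has the determinant of a
  block matrix only over integral domains.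
\<close>

lemma has_minor_jordan_type_ring:
  fixes \<phi> :: "'k::field \<Rightarrow> 'r::comm_ring_1"
  assumes hom: "comm_ring_hom \<phi>" and "0 < q" "q \<le> m" "m \<in> set ms"
  shows "has_minor \<phi> (jordan_type ms \<eta> ^\<^sub>m m) (Suc (\<Sum>m'\<leftarrow>ms. m' - m)) (of_nat (m choose q) * \<eta> ^ q)"
proof -
  let ?\<theta> = "\<lambda>f. poly (map_poly \<phi> f) \<eta>"
  interpret \<phi>: comm_ring_hom \<phi> by fact
  have \<theta>: "comm_ring_hom ?\<theta>" by (rule comm_ring_hom_eval_map_poly[OF hom])
  interpret \<theta>: comm_ring_hom ?\<theta> by (rule \<theta>)
  have "comm_ring_hom (\<lambda>c::'k. [:c:])" by unfold_locales (auto simp: one_pCons)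
  from has_minor_hom[OF has_minor_jordan_type_extra[OF this assms(2-4), of "[:0, 1:]"] \<theta>]
  have "has_minor (\<lambda>x. ?\<theta> [:x:]) (map_mat ?\<theta> (jordan_type ms [:0, 1:] ^\<^sub>m m))
      (Suc (\<Sum>m'\<leftarrow>ms. m' - m)) (?\<theta> (of_nat (m choose q) * [:0, 1:] ^ q))" .
  moreover have "?\<theta> [:x:] = \<phi> x" for x by (simp add: Polynomial.map_poly_pCons[of \<phi>, OF \<phi>.hom_zero])
  moreover have t: "?\<theta> [:0, 1:] = \<eta>" by (simp add: Polynomial.map_poly_pCons[of \<phi>, OF \<phi>.hom_zero])
  moreover have "map_mat ?\<theta> (jordan_type ms [:0, 1:] ^\<^sub>m m) = jordan_type ms \<eta> ^\<^sub>m m"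
    by (subst \<theta>.mat_hom_pow[OF jordan_type_carrier]) (simp only: map_jordan_type[OF \<theta>] t)
  moreover have "?\<theta> (of_nat (m choose q) * [:0, 1:] ^ q) = of_nat (m choose q) * \<eta> ^ q"
    by (simp only: \<theta>.hom_mult \<theta>.hom_power \<theta>.hom_of_nat t)
  ultimately show ?thesis by simp
qed

lemma stabilizing_scalar_root_of_unity:
  fixes u :: "'k::alg_closed_field mat" and \<phi> :: "'k \<Rightarrow> 'r::comm_ring_1"
  assumes hom: "comm_ring_hom \<phi>" and u: "u \<in> carrier_mat n n" and n: "n \<ge> 1"
    and J: "similar_mat u (jordan_type ms 1)"
    and char: "prime CHAR('k)" "q = CHAR('k) ^ r"
    and m: "q * a \<in> set ms" "a > 0" "\<not> CHAR('k) dvd a"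
    and \<zeta>: "\<zeta> ^ n = 1"
    and vanish: "\<And>f. f \<in> vanishing_ideal n (conj_class n u) \<Longrightarrow>
      eval_poly_at \<phi> (\<zeta> \<cdot>\<^sub>m map_mat \<phi> u) f = 0"
  shows "\<zeta> ^ q = 1"
proof -
  interpret \<phi>: comm_ring_hom \<phi> by fact
  have q: "q > 0" using char prime_gt_0_nat by simp
  define m where "m = q * a"
  let ?s = "Suc (\<Sum>m'\<leftarrow>ms. m' - m)"
  \<comment> \<open>The inverse of \<zeta> is \<zeta>^(n - 1), so this is 1 - 1/\<zeta>.\<close>
  define \<eta> where "\<eta> = 1 - \<zeta> ^ (n - 1)"
  have "\<zeta> ^ (n - 1) * \<zeta> = 1" using power_minus_mult[of n \<zeta>] n \<zeta> by simp
  hence \<eta>: "\<zeta> * \<eta> = \<zeta> - 1" by (simp add: \<eta>_def algebra_simps)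
  note sum = similar_jordan_type_sum_list[OF J u]
  obtain g h where g: "g \<in> carrier_mat n n" and h: "h \<in> carrier_mat n n"
    and gh: "g * h = 1\<^sub>m n" "h * g = 1\<^sub>m n" and ueq: "u = g * jordan_type ms 1 * h"
    using similar_matE[OF J jordan_type_carrier] unfolding sum by metis
  let ?J = "jordan_type ms \<eta> ^\<^sub>m m"
  have Jc: "?J \<in> carrier_mat n n" using pow_carrier_mat[OF jordan_type_carrier[of \<eta> ms], of m] sum by simp
  obtain P Q where P: "P \<in> carrier_mat ?s n" and Q: "Q \<in> carrier_mat n ?s"
    and det: "det (map_mat \<phi> P * ?J * map_mat \<phi> Q) = of_nat (m choose q) * \<eta> ^ q"
    using has_minor_jordan_type_ring[OF hom q, of m ms \<eta>] m m_def
    unfolding has_minor_def carrier_matD[OF Jc] by auto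
  let ?G = "map_mat \<phi> g" and ?H = "map_mat \<phi> h" and ?U = "map_mat \<phi> u"
  have GH: "?G \<in> carrier_mat n n" "?H \<in> carrier_mat n n" "?G * ?H = 1\<^sub>m n" "?H * ?G = 1\<^sub>m n"
    using g h gh by (auto simp: \<phi>.mat_hom_mult[symmetric] \<phi>.mat_hom_one)
  have J1: "jordan_type ms (1::'k) \<in> carrier_mat n n" using jordan_type_carrier[of "1::'k" ms] sum by simp
  have "?U = ?G * map_mat \<phi> (jordan_type ms 1) * ?H"
    unfolding ueq using g h J1 by (simp add: \<phi>.mat_hom_mult[of _ n n _ n])
  hence U: "?U = ?G * jordan_type ms 1 * ?H" by (simp add: map_jordan_type[OF hom])
  have Uc: "\<zeta> \<cdot>\<^sub>m ?U \<in> carrier_mat n n" using u by simp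
  have Ph: "P * h \<in> carrier_mat ?s n" and gQ: "g * Q \<in> carrier_mat n ?s" using P Q g h by auto
  \<comment> \<open>The conjugators are absorbed into \<open>P * h\<close> and \<open>g * Q\<close>,
    so the value at \<zeta> u is the minor of the Jordan matrix up to a power of \<zeta>. Its size
    exceeds the rank of (u - 1)^m by one, which puts the polynomial in the ideal of the
    class.\<close>
  have "0 = eval_poly_at \<phi> (\<zeta> \<cdot>\<^sub>m ?U) (minor_poly n (P * h) (g * Q) m)"
    by (rule vanish[symmetric], rule minor_poly_vanishes[OF u n J Ph gQ]) simp
  also have "\<dots> = det ((map_mat \<phi> P * ?H) * (\<zeta> ^ m \<cdot>\<^sub>m (?G * ?J * ?H)) * (?G * map_mat \<phi> Q))"
    unfolding eval_minor_poly[OF hom Uc Ph gQ] \<phi>.mat_hom_mult[OF P h] \<phi>.mat_hom_mult[OF g Q]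
    by (simp only: U scaled_unipotent_power[OF \<eta> sum GH])
  also have "(map_mat \<phi> P * ?H) * (\<zeta> ^ m \<cdot>\<^sub>m (?G * ?J * ?H)) * (?G * map_mat \<phi> Q) =
      \<zeta> ^ m \<cdot>\<^sub>m ((map_mat \<phi> P * ?H) * (?G * ?J * ?H) * (?G * map_mat \<phi> Q))"
  proof -
    have c: "map_mat \<phi> P * ?H \<in> carrier_mat ?s n" "?G * ?J * ?H \<in> carrier_mat n n"
      "?G * map_mat \<phi> Q \<in> carrier_mat n ?s"
      by (rule mult_carrier_mat, (use P in simp), rule GH(2))
         (rule mult_carrier_mat[OF mult_carrier_mat[OF GH(1) Jc] GH(2)],
          rule mult_carrier_mat[OF GH(1)], use Q in simp)
    show ?thesis
      unfolding mult_smult_distrib[OF c(1,2)] mult_smult_assoc_mat[OF mult_carrier_mat[OF c(1,2)] c(3)] ..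
  qed
  also have "(map_mat \<phi> P * ?H) * (?G * ?J * ?H) * (?G * map_mat \<phi> Q) = map_mat \<phi> P * ?J * map_mat \<phi> Q"
    by (rule conjugate_minor[OF Jc GH(1,2,4)]) (use P Q in auto)
  also have "det (\<zeta> ^ m \<cdot>\<^sub>m (map_mat \<phi> P * ?J * map_mat \<phi> Q)) = \<zeta> ^ (m * ?s) * (of_nat (m choose q) * \<eta> ^ q)"
    unfolding det_smult det using Q by (simp add: power_mult power_add)
  also have "(of_nat (m choose q) :: 'r) = \<phi> (of_nat a)"
    using of_nat_binomial_prime_power[OF char, of a] by (metis m_def \<phi>.hom_of_nat)
  finally have "\<zeta> ^ (m * ?s) * (\<phi> (of_nat a) * \<eta> ^ q) = 0" by simp
  \<comment> \<open>Cancel the units: \<zeta> has inverse \<zeta>^(n - 1), and a is nonzero in k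
    since p does not divide it.\<close>
  hence "(\<zeta> ^ (n - 1)) ^ (m * ?s) * (\<phi> (inverse (of_nat a)) * (\<zeta> ^ (m * ?s) * (\<phi> (of_nat a) * \<eta> ^ q))) = 0"
    by simp
  moreover have "(\<zeta> ^ (n - 1)) ^ (m * ?s) * \<zeta> ^ (m * ?s) = 1"
    unfolding power_mult_distrib[symmetric] \<open>\<zeta> ^ (n - 1) * \<zeta> = 1\<close> by simp
  moreover have "\<phi> (inverse (of_nat a)) * \<phi> (of_nat a) = 1"
    unfolding \<phi>.hom_mult[symmetric] using m(3) by (simp add: of_nat_eq_0_iff_char_dvd)
  ultimately have "\<eta> ^ q = 0"
    by (metis (no_types, lifting) mult.assoc mult.left_commute mult_1)
  hence "(\<zeta> - 1) ^ q = 0" unfolding \<eta>[symmetric] by (simp add: power_mult_distrib)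
  moreover have "CHAR('r) = CHAR('k)" by (rule CHAR_eq_if_comm_ring_hom[OF hom char(1)])
  ultimately show "\<zeta> ^ q = 1"
    using power_prime_power_minus_one[of q r \<zeta>] char by simp
qed

text \<open>A k-algebra R is given by its structure map \<open>\<phi>\<close>. Since
  \<open>\<phi>\<close> and its target type are arbitrary, equality of R-points is equality of
  subfunctors of the centre, hence of subgroup schemes.\<close>

theorem proposition4p24:
  fixes u :: "'k::alg_closed_field mat"
    and n p r :: nat
    and ms :: "nat list"
    and \<phi> :: "'k \<Rightarrow> 'r::comm_ring_1"
  assumes "CHAR('k) = p" and "p > 0"
    and "n \<ge> 1"
    and "u \<in> SL n"
    and "unipotent_mat n u"
    and "jordan_nf u (map (\<lambda>m. (m, 1)) ms)"
    and "\<forall>m \<in> set ms. p ^ r dvd m"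
    and "\<not> (\<forall>m \<in> set ms. p ^ Suc r dvd m)"
    and "comm_ring_hom \<phi>"
  shows "class_stabilizer n \<phi> u = mu_scalar n (p ^ r)
    \<and> mu_scalar n (p ^ r) \<subseteq> (SL_centre n :: 'r mat set)
    \<and> (SL_centre n :: 'r mat set) = mu_scalar n n"
proof -
  let ?q = "p ^ r" and ?C = "conj_class n u"
  note hom = \<open>comm_ring_hom \<phi>\<close> and n = \<open>n \<ge> 1\<close>
  have p: "prime p" using prime_CHAR_semidom[where 'a = 'k] assms(1,2) by simp
  have char: "prime CHAR('k)" "?q = CHAR('k) ^ r" using p assms(1) by auto
  have charr: "prime CHAR('r)" "?q = CHAR('r) ^ r"
    using CHAR_eq_if_comm_ring_hom[OF hom char(1)] p assms(1) by auto
  have q: "?q > 0" using p prime_gt_0_nat by simp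
  have u: "u \<in> carrier_mat n n" using assms(4) by (simp add: SL_def)
  have J: "similar_mat u (jordan_type ms 1)" and ms0: "0 \<notin> set ms"
    using assms(6) by (force simp: jordan_nf_def)+
  have "?q dvd sum_list ms" using assms(7) by (induction ms) auto
  hence qn: "?q dvd n" unfolding similar_jordan_type_sum_list[OF J u] .
  have centre: "(SL_centre n :: 'r mat set) = mu_scalar n n" by (rule SL_centre_eq[OF n])
  have sub: "mu_scalar n ?q \<subseteq> (SL_centre n :: 'r mat set)"
    unfolding centre by (rule mu_scalar_mono[OF qn])
  have "class_stabilizer n \<phi> u = mu_scalar n ?q"
  proof (intro equalityI subsetI)
    fix Z assume Z: "Z \<in> class_stabilizer n \<phi> u"
    then obtain \<zeta> where Z_eq: "Z = \<zeta> \<cdot>\<^sub>m 1\<^sub>m n" and \<zeta>: "\<zeta> ^ n = 1"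
      using centre by (auto simp: class_stabilizer_def mu_scalar_def)
    have stab: "translate_subscheme n (\<zeta> \<cdot>\<^sub>m 1\<^sub>m n) (reduced_subscheme_base_change n \<phi> ?C) =
        reduced_subscheme_base_change n \<phi> ?C"
      using Z unfolding Z_eq by (simp add: class_stabilizer_def)
    obtain F where F: "F \<in> vanishing_ideal n (zariski_closure n ?C - ?C)" "eval_poly_at id u F \<noteq> 0"
      using boundary_separated[OF u n assms(5) J ms0] by blast
    have uC: "u \<in> ?C" using conj_class_iff[OF u n] similar_mat_refl[OF u] by blast
    \<comment> \<open>By maximality of r some block size has p-part exactly q; that block supplies
      the decisive minor.\<close>
    from assms(8) obtain m where m: "m \<in> set ms" "\<not> p ^ Suc r dvd m" by blast
    with assms(7) obtain a where a: "m = ?q * a" by auto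
    have "a > 0" using m ms0 a by (cases a) auto
    moreover have "\<not> CHAR('k) dvd a" using m(2) a assms(1) by (auto simp: mult.commute)
    ultimately have "\<zeta> ^ ?q = 1"
      using stabilizing_scalar_root_of_unity[OF hom u n J char _ _ _ \<zeta>]
        vanishes_on_stabilizing_translate[OF hom u uC F stab] m(1) a by blast
    thus "Z \<in> mu_scalar n ?q" unfolding Z_eq mu_scalar_def by blast
  next
    fix Z :: "'r mat" assume Z: "Z \<in> mu_scalar n ?q"
    then obtain \<zeta> where Z_eq: "Z = \<zeta> \<cdot>\<^sub>m 1\<^sub>m n" and \<zeta>: "\<zeta> ^ ?q = 1" by (auto simp: mu_scalar_def)
    have "translate_subscheme n Z (reduced_subscheme_base_change n \<phi> ?C) = reduced_subscheme_base_change n \<phi> ?C"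
      unfolding Z_eq reduced_subscheme_base_change_def
    proof (rule translate_lc_subscheme_eq[OF charr \<zeta>])
      fix \<xi> :: 'r and f assume \<xi>: "\<xi> ^ ?q = 1" and f: "f \<in> extended_ideal n \<phi> (vanishing_ideal n ?C)"
      have "vanishing_ideal n ?C \<subseteq> entry_polys n" by (auto simp: vanishing_ideal_def)
      thus "scale_vars n \<xi> f \<in> extended_ideal n \<phi> (vanishing_ideal n ?C)"
        by (rule scale_vars_extended_ideal[OF hom _ q \<xi> _ f])
           (rule vanishing_ideal_conj_class_graded[OF u n J char assms(7)])
    qed
    thus "Z \<in> class_stabilizer n \<phi> u" using Z sub by (auto simp: class_stabilizer_def)
  qed
  thus ?thesis using sub centre by blast
qed

end
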